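(* Let $F:\mathbb{R}\to\mathbb{R}$ be differentiable with bounded derivative, and let $\varepsilon>0$. Then for Lebesgue-almost every $\theta\in\mathbb{R}$ there is a constant $C=C(\theta,F,\varepsilon)$ such that for all $N\geq 2$, \[ \left|\frac{1}{N}\sum_{k=1}^N F\bigl(q_k|\theta q_k-p_k|\bigr)-\int_0^1 F(z)\,d\nu(z)\right|\leq C\,N^{-1/2}(\log N)^{3/2+\varepsilon}, \] where $p_k/q_k$ are the continued fraction convergents of $\theta$ and $\nu$ is the probability measure on $[0,1]$ described in the context.
   Context: For irrational $\theta=a_0+\cfrac{1}{a_1+\cfrac{1}{a_2+\cdots}}$ with $a_0\in\mathbb{Z}$, $a_j\in\mathbb{N}$ for $j\ge1$, the $k$-th convergent is $p_k/q_k=a_0+\cfrac{1}{a_1+\cfrac{1}{\ddots+\cfrac{1}{a_k}}}$ with $p_k,q_k$ coprime integers. The measure $\nu$ on $[0,1]$ has density $\frac{d\nu}{dz}=\frac{1}{\ln 2}$ for $0\le z\le 1/2$ and $\frac{d\nu}{dz}=\frac{1-1/z}{\ln 2}$ for $1/2<z\le 1$.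
   Formalization: The density of ν on (1/2,1] is taken as (1/z−1)/ln 2 instead of the printed (1−1/z)/ln 2, which is negative there, so that ν would not be a probability measure and the claim would fail for F = 1. *)

theory Defs
  imports "HOL-Probability.Probability"
begin

text \<open>\<^term>\<open>cf_value a k\<close> is the finite continued fraction with partial quotients
  \<open>a 0, \<dots>, a k\<close>.\<close>

primrec cf_value :: "(nat \<Rightarrow> int) \<Rightarrow> nat \<Rightarrow> rat" where
  "cf_value a 0 = of_int (a 0)"
| "cf_value a (Suc k) = of_int (a 0) + 1 / cf_value (\<lambda>j. a (Suc j)) k"

definition is_cf_expansion :: "(nat \<Rightarrow> int) \<Rightarrow> real \<Rightarrow> bool" where
  "is_cf_expansion a \<theta> \<longleftrightarrow>
     (\<forall>j\<ge>1. 1 \<le> a j) \<and> (\<lambda>k. real_of_rat (cf_value a k)) \<longlonglongrightarrow> \<theta>"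

text \<open>Meaningful only for irrational \<open>\<theta>\<close>, where the expansion exists and is unique; see
  \<open>ex1_cf_expansion\<close> below.\<close>

definition cf_quotients :: "real \<Rightarrow> nat \<Rightarrow> int" where
  "cf_quotients \<theta> = (THE a. is_cf_expansion a \<theta>)"

text \<open>The library function \<^const>\<open>quotient_of\<close> returns the coprime numerator and denominator of a
  rational number, with the denominator positive.\<close>

definition cf_num :: "real \<Rightarrow> nat \<Rightarrow> int" where
  "cf_num \<theta> k = fst (quotient_of (cf_value (cf_quotients \<theta>) k))"

definition cf_denom :: "real \<Rightarrow> nat \<Rightarrow> int" where
  "cf_denom \<theta> k = snd (quotient_of (cf_value (cf_quotients \<theta>) k))"

text \<open>On \<open>(1/2, 1]\<close> the density is \<open>(1/z - 1) / ln 2\<close>. The opposite sign \<open>(1 - 1/z) / ln 2\<close> would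
  make it negative there, and \<open>\<nu>\<close> would not be a probability measure; see \<open>prob_space_nu\<close> below.\<close>

definition nu_density :: "real \<Rightarrow> real" where
  "nu_density z =
     (if 0 \<le> z \<and> z \<le> 1/2 then 1 / ln 2
      else if 1/2 < z \<and> z \<le> 1 then (1/z - 1) / ln 2
      else 0)"

definition nu :: "real measure" where
  "nu = density lborel (\<lambda>z. ennreal (nu_density z))"


subsection \<open>Existence and uniqueness of the expansion\<close>

abbreviation (input) rcf :: "(nat \<Rightarrow> int) \<Rightarrow> nat \<Rightarrow> real" where
  "rcf a k \<equiv> real_of_rat (cf_value a k)"

lemma rcf_Suc: "rcf a (Suc k) = of_int (a 0) + 1 / rcf (\<lambda>j. a (Suc j)) k"
  by (simp add: of_rat_add of_rat_divide)

lemma rcf_bounds: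
  assumes "\<And>j. 1 \<le> a j"
  shows "1 \<le> rcf a k \<and> rcf a k \<le> of_int (a 0) + 1"
  using assms
proof (induction k arbitrary: a)
  case 0
  then show ?case by simp
next
  case (Suc k)
  have b: "1 \<le> rcf (\<lambda>j. a (Suc j)) k"
    using Suc.IH[of "\<lambda>j. a (Suc j)"] Suc.prems by simp
  have "1 \<le> real_of_int (a 0)" using Suc.prems[of 0] by simp
  moreover have "0 \<le> 1 / rcf (\<lambda>j. a (Suc j)) k" "1 / rcf (\<lambda>j. a (Suc j)) k \<le> 1"
    using b by (simp_all add: divide_le_eq)
  ultimately show ?case unfolding rcf_Suc by linarith
qed

lemma cf_expansion_tail:
  assumes e: "is_cf_expansion a \<theta>" and irr: "\<theta> \<notin> \<rat>"
  shows "a 0 = \<lfloor>\<theta>\<rfloor>" and "is_cf_expansion (\<lambda>j. a (Suc j)) (1 / frac \<theta>)"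
proof -
  let ?b = "\<lambda>j. a (Suc j)"
  have b1: "\<And>j. 1 \<le> ?b j" and lim: "rcf a \<longlonglongrightarrow> \<theta>"
    using e by (auto simp: is_cf_expansion_def)
  have bb: "1 \<le> rcf ?b k \<and> rcf ?b k \<le> of_int (?b 0) + 1" for k
    by (rule rcf_bounds) (rule b1)
  have "(\<lambda>k. rcf a (Suc k) - of_int (a 0)) \<longlonglongrightarrow> \<theta> - of_int (a 0)"
    using LIMSEQ_Suc[OF lim] by (intro tendsto_intros)
  then have l: "(\<lambda>k. 1 / rcf ?b k) \<longlonglongrightarrow> \<theta> - of_int (a 0)"
    by (simp only: rcf_Suc add_diff_cancel_left')
  have "\<theta> - of_int (a 0) \<le> 1"
    using bb
    by (intro LIMSEQ_le_const2[OF l] exI[of _ 0] allI impI)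
       (auto simp: divide_le_eq not_less intro: less_le_trans[OF zero_less_one])
  moreover have lo: "1 / (of_int (?b 0) + 1) \<le> \<theta> - of_int (a 0)"
    using bb by (intro LIMSEQ_le_const[OF l] exI[of _ 0] allI impI frac_le) (auto intro: less_le_trans[OF zero_less_one])
  moreover have "0 < 1 / (of_int (?b 0) + 1 :: real)"
    using b1[of 0] by simp
  moreover have "\<theta> - of_int (a 0) \<noteq> 1"
  proof
    assume "\<theta> - of_int (a 0) = 1"
    then have "\<theta> = of_int (a 0 + 1)" by simp
    then show False using irr Rats_of_int by metis
  qed
  ultimately have pos: "0 < \<theta> - of_int (a 0)" "\<theta> - of_int (a 0) < 1" by linarith+
  show a0: "a 0 = \<lfloor>\<theta>\<rfloor>" using pos by linarith
  have "(\<lambda>k. 1 / (1 / rcf ?b k)) \<longlonglongrightarrow> 1 / (\<theta> - of_int (a 0))"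
    using pos by (intro tendsto_divide tendsto_const l) auto
  then show "is_cf_expansion ?b (1 / frac \<theta>)"
    using b1 by (simp add: is_cf_expansion_def frac_def a0)
qed

lemma irrational_inverse_frac:
  assumes "(\<theta>::real) \<notin> \<rat>"
  shows "1 / frac \<theta> \<notin> \<rat>" and "1 < 1 / frac \<theta>"
proof -
  have n: "frac \<theta> \<notin> \<rat>"
    using assms Rats_add[of "frac \<theta>" "of_int \<lfloor>\<theta>\<rfloor>"] by (auto simp: frac_def)
  then show "1 / frac \<theta> \<notin> \<rat>"
    using Rats_divide[OF Rats_1, of "1 / frac \<theta>"] by auto
  have "frac \<theta> \<noteq> 0" using n Rats_0 by metis
  then have "0 < frac \<theta>" and "frac \<theta> < 1"
    using frac_ge_0[of \<theta>] frac_lt_1[of \<theta>] by linarith+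
  then show "1 < 1 / frac \<theta>" by simp
qed

lemma cf_expansion_unique:
  assumes "\<theta> \<notin> \<rat>" "is_cf_expansion a \<theta>" "is_cf_expansion b \<theta>"
  shows "a n = b n"
  using assms
proof (induction n arbitrary: a b \<theta>)
  case 0
  then show ?case
    by (simp add: cf_expansion_tail(1)[of a \<theta>] cf_expansion_tail(1)[of b \<theta>])
next
  case (Suc n)
  then show ?case
    by (intro Suc.IH[OF irrational_inverse_frac(1) cf_expansion_tail(2) cf_expansion_tail(2)])
qed

lemma cf_expansion_exists:
  assumes irr: "\<theta> \<notin> \<rat>"
  shows "is_cf_expansion (\<lambda>n. \<lfloor>((\<lambda>y. 1 / frac y) ^^ n) \<theta>\<rfloor>) \<theta>"
proof -
  define x where "x n = ((\<lambda>y::real. 1 / frac y) ^^ n) \<theta>" for n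
  define a where "a m j = \<lfloor>x (m + j)\<rfloor>" for m j :: nat
  have x0: "x 0 = \<theta>" and xS: "x (Suc n) = 1 / frac (x n)" for n by (simp_all add: x_def)
  have xirr: "x n \<notin> \<rat>" for n
    by (induction n) (use irr in \<open>simp_all add: x0 xS irrational_inverse_frac\<close>)
  have x1: "1 < x (Suc n)" for n
    unfolding xS by (rule irrational_inverse_frac(2)[OF xirr])
  have xeq: "x n = of_int \<lfloor>x n\<rfloor> + 1 / x (Suc n)" for n
    by (simp add: xS frac_def)
  have a1: "1 \<le> a (Suc m) j" for m j
    using x1[of "m + j"] by (simp add: a_def)
  have shift: "(\<lambda>j. a m (Suc j)) = a (Suc m)" for m by (rule ext) (simp add: a_def)
  have vS: "rcf (a m) (Suc k) = of_int \<lfloor>x m\<rfloor> + 1 / rcf (a (Suc m)) k" for m k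
    unfolding rcf_Suc shift by (simp add: a_def)
  have v1: "1 \<le> rcf (a (Suc m)) k" for m k
    using rcf_bounds[of "a (Suc m)" k] a1 by blast
  have step: "\<bar>x m - rcf (a m) (Suc k)\<bar> =
      \<bar>x (Suc m) - rcf (a (Suc m)) k\<bar> / (x (Suc m) * rcf (a (Suc m)) k)" for m k
  proof -
    let ?y = "x (Suc m)" and ?v = "rcf (a (Suc m)) k"
    have p: "0 < ?y" "0 < ?v" using x1[of m] v1[of m k] by linarith+
    have "x m - rcf (a m) (Suc k) = 1 / ?y - 1 / ?v"
      by (subst xeq) (simp only: vS)
    also have "\<dots> = (?v - ?y) / (?y * ?v)" using p by (simp add: field_simps)
    finally show ?thesis using p by (simp add: abs_mult abs_minus_commute)
  qed
  have err: "\<bar>x m - rcf (a m) k\<bar> \<le> (1/2) ^ (k div 2)" for m k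
  proof (induction k arbitrary: m rule: induct_nat_012)
    case 0
    have "\<bar>x m - of_int \<lfloor>x m\<rfloor>\<bar> \<le> 1" by linarith
    then show ?case by (simp add: a_def)
  next
    case 1
    have "\<bar>x (Suc m) - of_int \<lfloor>x (Suc m)\<rfloor>\<bar> \<le> 1" by linarith
    then have "\<bar>x (Suc m) - rcf (a (Suc m)) 0\<bar> \<le> 1" by (simp add: a_def)
    moreover have "1 \<le> x (Suc m) * rcf (a (Suc m)) 0"
      using mult_mono[of 1 "x (Suc m)" 1 "rcf (a (Suc m)) 0"] x1[of m] v1[of m 0] by simp
    ultimately show ?case
      using step[of m 0] by (simp add: divide_le_eq)
  next
    case (ge2 k)
    let ?y = "x (Suc m)" and ?v = "rcf (a (Suc m)) (Suc k)"
    let ?z = "x (Suc (Suc m))" and ?w = "rcf (a (Suc (Suc m))) k"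
    let ?c = "real_of_int \<lfloor>?y\<rfloor>"
    have c: "1 \<le> ?c" using x1[of m] by simp
    have z: "1 < ?z" and w: "1 \<le> ?w" using x1 v1 by blast+
    have "?y * ?z = ?c * ?z + 1" using z by (subst xeq) (simp add: field_simps)
    moreover have "?c * ?z \<ge> 1" using mult_mono[of 1 ?c 1 ?z] c z by simp
    ultimately have yz: "2 \<le> ?y * ?z" by linarith
    have "?v * ?w = ?c * ?w + 1" using w by (simp only: vS) (simp add: field_simps)
    moreover have "?c * ?w \<ge> 1" using mult_mono[of 1 ?c 1 ?w] c w by simp
    ultimately have vw: "1 \<le> ?v * ?w" by linarith
    have big: "2 \<le> (?y * ?z) * (?v * ?w)"
      using mult_mono[OF yz vw] yz by simp
    have "\<bar>x m - rcf (a m) (Suc (Suc k))\<bar> = \<bar>?z - ?w\<bar> / ((?y * ?z) * (?v * ?w))"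
      unfolding step[of m "Suc k"] step[of "Suc m" k] by (simp add: mult_ac)
    also have "\<dots> \<le> \<bar>?z - ?w\<bar> / 2"
      using big by (intro divide_left_mono) auto
    also have "\<dots> \<le> (1/2) ^ (k div 2) / 2"
      using ge2(1)[of "Suc (Suc m)"] by simp
    finally show ?case by simp
  qed
  have "filterlim (\<lambda>k. k div 2) sequentially (sequentially :: nat filter)"
    unfolding filterlim_at_top eventually_sequentially
  proof
    fix Z :: nat
    show "\<exists>N. \<forall>n\<ge>N. Z \<le> n div 2" by (intro exI[of _ "2 * Z"]) auto
  qed
  then have "(\<lambda>k. (1/2::real) ^ (k div 2)) \<longlonglongrightarrow> 0"
    by (rule filterlim_compose[rotated]) (rule LIMSEQ_power_zero, simp)
  then have "(\<lambda>k. x 0 - rcf (a 0) k) \<longlonglongrightarrow> 0"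
    by (rule Lim_null_comparison[rotated]) (use err in \<open>simp\<close>)
  then have "rcf (a 0) \<longlonglongrightarrow> \<theta>"
    using tendsto_diff[OF tendsto_const[of "x 0"], of "\<lambda>k. x 0 - rcf (a 0) k" 0] by (simp add: x0)
  moreover have "1 \<le> a 0 j" if "1 \<le> j" for j
    using a1[of 0 "j - 1"] that by (simp add: a_def)
  ultimately have "is_cf_expansion (a 0) \<theta>" by (simp add: is_cf_expansion_def)
  moreover have "a 0 = (\<lambda>n. \<lfloor>((\<lambda>y. 1 / frac y) ^^ n) \<theta>\<rfloor>)"
    by (rule ext) (simp add: a_def x_def)
  ultimately show ?thesis by simp
qed

lemma ex1_cf_expansion:
  assumes "\<theta> \<notin> \<rat>"
  shows "\<exists>!a. is_cf_expansion a \<theta>"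
proof (rule ex1I)
  show "is_cf_expansion (\<lambda>n. \<lfloor>((\<lambda>y. 1 / frac y) ^^ n) \<theta>\<rfloor>) \<theta>"
    by (rule cf_expansion_exists[OF assms])
next
  fix a
  assume "is_cf_expansion a \<theta>"
  then show "a = (\<lambda>n. \<lfloor>((\<lambda>y. 1 / frac y) ^^ n) \<theta>\<rfloor>)"
    using cf_expansion_exists[OF assms] by (intro ext cf_expansion_unique[OF assms])
qed

lemma cf_expansion_cf_quotients:
  assumes "\<theta> \<notin> \<rat>"
  shows "is_cf_expansion (cf_quotients \<theta>) \<theta>"
  unfolding cf_quotients_def by (rule theI'[OF ex1_cf_expansion[OF assms]])


subsection \<open>The measure is a probability measure\<close>

lemma nu_density_nonneg: "0 \<le> nu_density z"
  by (auto simp: nu_density_def)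

lemma nu_density_measurable [measurable]: "nu_density \<in> borel_measurable borel"
  unfolding nu_density_def by measurable

lemma prob_space_nu: "prob_space nu"
proof
  have h1: "((\<lambda>z::real. 1 / ln 2 :: real) has_integral (1/2) / ln 2) {0..1/2}"
    using has_integral_const_real[of "1 / ln 2 :: real" 0 "1/2"] by simp
  have h2: "((\<lambda>z::real. (1/z - 1) / ln 2) has_integral (ln 1 - 1) / ln 2 - (ln (1/2) - 1/2) / ln 2) {1/2..1}"
  proof (rule fundamental_theorem_of_calculus)
    fix z :: real
    assume "z \<in> {1/2..1}"
    then have "0 < z" by simp
    then have "((\<lambda>z. (ln z - z) / ln 2) has_real_derivative (1 / z - 1) / ln 2) (at z within {1/2..1})"
      by (intro DERIV_cdivide DERIV_diff DERIV_ident DERIV_subset[OF DERIV_ln_divide subset_UNIV])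
    then show "((\<lambda>z. (ln z - z) / ln 2) has_vector_derivative (1 / z - 1) / ln 2) (at z within {1/2..1})"
      by (simp only: has_real_derivative_iff_has_vector_derivative)
  qed simp
  have g1: "(nu_density has_integral (1/2) / ln 2) {0..1/2}"
    by (rule has_integral_eq[OF _ h1]) (simp add: nu_density_def)
  have g2: "(nu_density has_integral (ln 1 - 1) / ln 2 - (ln (1/2) - 1/2) / ln 2) {1/2..1}"
    by (rule has_integral_spike_finite[OF _ _ h2, of "{1/2}"]) (auto simp: nu_density_def)
  have val: "(1/2) / ln 2 + ((ln 1 - 1) / ln 2 - (ln (1/2) - 1/2) / ln 2) = (1::real)"
    by (simp add: ln_div diff_divide_distrib add_divide_distrib)
  have "(nu_density has_integral 1) {0..1}"
    using has_integral_combine[OF _ _ g1 g2] unfolding val by simp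
  then have "(nu_density has_integral 1) UNIV"
    by (rule has_integral_on_superset) (auto simp: nu_density_def)
  then have "(\<integral>\<^sup>+ z. ennreal (nu_density z) \<partial>lborel) = 1"
    using nn_integral_has_integral_lborel[of nu_density 1] nu_density_nonneg by simp
  then show "emeasure nu (space nu) = 1"
    by (simp add: nu_def emeasure_density)
qed

end

theory Submission
  imports Defs "HOL-Real_Asymp.Real_Asymp"
begin

text \<open>Write \<open>t\<^sub>k\<close> for the \<open>k\<close>-th iterate of the Gauss map at \<open>frac \<theta>\<close> and \<open>v\<^sub>k = q\<^sub>k\<^sub>-\<^sub>1 / q\<^sub>k\<close>, so that
  \<open>q\<^sub>k \<bar>\<theta> q\<^sub>k - p\<^sub>k\<bar> = t\<^sub>k / (1 + t\<^sub>k v\<^sub>k)\<close>. Under Lebesgue measure on \<open>[0, 1]\<close> the \<open>v\<^sub>k\<close> form a Markov chain,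
  and given the first \<open>k\<close> partial quotients \<open>t\<^sub>k\<close> has density \<open>(1 + v\<^sub>k) / (1 + v\<^sub>k t)\<^sup>2\<close>. The transition
  operator contracts Lipschitz seminorms by a factor \<open>11/12\<close> and leaves the Gauss measure invariant,
  which gives exponential decay of the conditional means of a centred observable. Since \<open>t\<^sub>j\<close> is
  determined up to an exponentially small error by the next few partial quotients, correlations decay
  exponentially as well, so block sums of length \<open>n\<close> have variance \<open>O(n)\<close>, and the Gal--Koksma
  dyadic chaining argument turns this into the almost sure bound.\<close>

section \<open>Convergents and the natural extension of the Gauss map\<close>

text \<open>The height at time k depends on the future \<open>t\<close> as well as on the past
  \<open>v\<close>, so it is not an observable of the Gauss map on [0, 1] alone. It is tractable
  because, given v, the height is uniform on [0, 1/(1+v)]. Its conditional mean is therefore a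
  function of v only, namely (1+v) times the integral of f over [0, 1/(1+v)], and averaging this
  against dv/(1+v) over [0, 1] is what produces \<open>nu\<close>. Conditional expectations are the
  explicit integrals \<open>cond_expect v\<close>, and conditioning on a digit is a convergent
  series, so all estimates hold for every v in [0, 1]. This uniformity replaces stationarity, which
  Lebesgue measure lacks. The supremum of a conditional mean is controlled without spectral theory:
  a Lipschitz function on [0, 1] with Gauss mean zero is bounded by its Lipschitz constant. Finally,
  a bounded derivative does not bound F, so F is clamped to [0, 1], where all heights lie.\<close>

primrec cf_ND :: "nat \<Rightarrow> (nat \<Rightarrow> int) \<Rightarrow> int \<times> int" where
  "cf_ND 0 a = (a 0, 1)"
| "cf_ND (Suc k) a = (let (n, d) = cf_ND k (\<lambda>j. a (Suc j)) in (a 0 * n + d, n))"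

abbreviation cf_N where "cf_N a k \<equiv> fst (cf_ND k a)"
abbreviation cf_D where "cf_D a k \<equiv> snd (cf_ND k a)"

lemma cf_N_Suc: "cf_N a (Suc k) = a 0 * cf_N (\<lambda>j. a (Suc j)) k + cf_D (\<lambda>j. a (Suc j)) k"
  and cf_D_Suc: "cf_D a (Suc k) = cf_N (\<lambda>j. a (Suc j)) k"
  by (simp_all add: case_prod_unfold Let_def)

lemma cf_ND_pos:
  assumes "\<And>j. 1 \<le> a j"
  shows "1 \<le> cf_N a k \<and> 1 \<le> cf_D a k"
  using assms
proof (induction k arbitrary: a)
  case (Suc k)
  have "1 \<le> cf_N (\<lambda>j. a (Suc j)) k \<and> 1 \<le> cf_D (\<lambda>j. a (Suc j)) k"
    using Suc.IH[of "\<lambda>j. a (Suc j)"] Suc.prems by simp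
  moreover from this have "1 \<le> a 0 * cf_N (\<lambda>j. a (Suc j)) k"
    using Suc.prems[of 0] mult_mono[of 1 "a 0" 1 "cf_N (\<lambda>j. a (Suc j)) k"] by simp
  ultimately show ?case unfolding cf_N_Suc cf_D_Suc by linarith
qed simp

lemma cf_D_pos:
  assumes "\<And>j. 1 \<le> j \<Longrightarrow> 1 \<le> a j"
  shows "1 \<le> cf_D a k"
proof (cases k)
  case (Suc m)
  then show ?thesis
    using cf_ND_pos[of "\<lambda>j. a (Suc j)" m] assms unfolding Suc cf_D_Suc by simp
qed simp

lemma cf_value_cf_ND:
  assumes "\<And>j. 1 \<le> j \<Longrightarrow> 1 \<le> a j"
  shows "cf_value a k = of_int (cf_N a k) / of_int (cf_D a k)"
  using assms
proof (induction k arbitrary: a)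
  case (Suc k)
  have 1: "1 \<le> cf_N (\<lambda>j. a (Suc j)) k"
    using cf_ND_pos[of "\<lambda>j. a (Suc j)" k] Suc.prems by simp
  have "cf_value (\<lambda>j. a (Suc j)) k = of_int (cf_N (\<lambda>j. a (Suc j)) k) / of_int (cf_D (\<lambda>j. a (Suc j)) k)"
    by (intro Suc.IH Suc.prems) simp
  then show ?case using 1
    unfolding cf_value.simps cf_N_Suc cf_D_Suc by (simp add: field_simps)
qed simp

lemma coprime_cf_ND: "coprime (cf_N a k) (cf_D a k)"
proof (induction k arbitrary: a)
  case (Suc k)
  show ?case
    unfolding cf_N_Suc cf_D_Suc
    using Suc[where a = "\<lambda>j. a (Suc j)"] by (simp add: coprime_iff_gcd_eq_1 gcd.commute gcd_add_mult)
qed simp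

text \<open>\<open>cf_ND\<close> unfolds at the front like \<open>cf_value\<close>, whereas the
  orbit of \<open>gauss_ext\<close> is driven by the newest quotient; hence this recursion at the
  far end. The joint proof is needed because the numerator step uses the induction hypothesis for
  both components of the shifted sequence.\<close>

lemma cf_N_rec: "cf_N a (Suc (Suc k)) = a (Suc (Suc k)) * cf_N a (Suc k) + cf_N a k"
  and cf_D_rec: "cf_D a (Suc (Suc k)) = a (Suc (Suc k)) * cf_D a (Suc k) + cf_D a k"
proof -
  have "cf_N a (Suc (Suc k)) = a (Suc (Suc k)) * cf_N a (Suc k) + cf_N a k \<and>
        cf_D a (Suc (Suc k)) = a (Suc (Suc k)) * cf_D a (Suc k) + cf_D a k"
  proof (induction k arbitrary: a)
    case 0
    show ?case by (simp add: algebra_simps)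
  next
    case (Suc k)
    let ?b = "\<lambda>j. a (Suc j)"
    have 1: "cf_N ?b (Suc (Suc k)) = a (Suc (Suc (Suc k))) * cf_N ?b (Suc k) + cf_N ?b k"
      and 2: "cf_D ?b (Suc (Suc k)) = a (Suc (Suc (Suc k))) * cf_D ?b (Suc k) + cf_D ?b k"
      using Suc[where a = ?b] by blast+
    have "cf_N a (Suc (Suc (Suc k))) = a (Suc (Suc (Suc k))) * cf_N a (Suc (Suc k)) + cf_N a (Suc k)"
      unfolding cf_N_Suc[where a = a] unfolding 1 2 by (simp only: algebra_simps)
    moreover have "cf_D a (Suc (Suc (Suc k))) = a (Suc (Suc (Suc k))) * cf_D a (Suc (Suc k)) + cf_D a (Suc k)"
      unfolding cf_D_Suc[where a = a] by (rule 1)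
    ultimately show ?case by blast
  qed
  then show "cf_N a (Suc (Suc k)) = a (Suc (Suc k)) * cf_N a (Suc k) + cf_N a k"
    and "cf_D a (Suc (Suc k)) = a (Suc (Suc k)) * cf_D a (Suc k) + cf_D a k" by blast+
qed

lemma cf_num_denom_eq:
  assumes "\<theta> \<notin> \<rat>"
  shows "cf_num \<theta> k = cf_N (cf_quotients \<theta>) k" "cf_denom \<theta> k = cf_D (cf_quotients \<theta>) k"
proof -
  let ?a = "cf_quotients \<theta>"
  have a: "\<And>j. 1 \<le> j \<Longrightarrow> 1 \<le> ?a j"
    using cf_expansion_cf_quotients[OF assms] by (simp add: is_cf_expansion_def)
  have "cf_value ?a k = Rat.Fract (cf_N ?a k) (cf_D ?a k)"
    unfolding Fract_of_int_quotient by (rule cf_value_cf_ND[OF a])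
  moreover have "Rat.normalize (cf_N ?a k, cf_D ?a k) = (cf_N ?a k, cf_D ?a k)"
    using cf_D_pos[where a = ?a and k = k, OF a] coprime_cf_ND[where a = ?a and k = k]
    by (intro normalize_stable) simp_all
  ultimately have "quotient_of (cf_value ?a k) = (cf_N ?a k, cf_D ?a k)"
    by (simp only: quotient_of_Fract)
  then show "cf_num \<theta> k = cf_N ?a k" "cf_denom \<theta> k = cf_D ?a k"
    by (simp_all add: cf_num_def cf_denom_def)
qed

text \<open>\<open>gauss_ext\<close> is the natural extension of the Gauss map. Its second coordinate along the orbit
  of \<open>(frac \<theta>, 0)\<close> is \<open>q_{k-1} / q_k\<close>.\<close>

definition gauss_ext :: "real \<times> real \<Rightarrow> real \<times> real" where
  "gauss_ext = (\<lambda>(t, v). (frac (1 / t), 1 / (of_int \<lfloor>1 / t\<rfloor> + v)))"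

definition gauss_height :: "real \<times> real \<Rightarrow> real" where
  "gauss_height = (\<lambda>(t, v). t / (1 + t * v))"

text \<open>Write e_k = \<theta> q_k - p_k. Then e_(k+1) = -t_(k+1) e_k and 1/t_k + v_k =
  q_(k+1)/q_k + t_(k+1), and the formula for q_k |e_k| follows by induction.\<close>

lemma approx_coeff_eq:
  assumes irr: "\<theta> \<notin> \<rat>"
  shows "of_int (cf_denom \<theta> k) * \<bar>\<theta> * of_int (cf_denom \<theta> k) - of_int (cf_num \<theta> k)\<bar>
    = gauss_height ((gauss_ext ^^ k) (frac \<theta>, 0))"
proof -
  define x where "x n = ((\<lambda>y::real. 1 / frac y) ^^ n) \<theta>" for n
  define t where "t n = frac (x n)" for n
  let ?a = "cf_quotients \<theta>"
  have x0: "x 0 = \<theta>" and xS: "x (Suc n) = 1 / t n" for n by (simp_all add: x_def t_def)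
  have xirr: "x n \<notin> \<rat>" for n
    by (induction n) (use irr in \<open>simp_all add: x0 xS t_def irrational_inverse_frac\<close>)
  have tpos: "0 < t n" for n
    using irrational_inverse_frac(2)[OF xirr[of n]] unfolding t_def
    by (metis frac_ge_0 less_eq_real_def zero_less_one div_by_0 order_less_asym)
  have a_eq: "?a n = \<lfloor>x n\<rfloor>" for n
    using cf_expansion_unique[OF irr cf_expansion_cf_quotients[OF irr] cf_expansion_exists[OF irr]]
    by (simp add: x_def)
  have aS: "of_int (?a (Suc n)) = 1 / t n - t (Suc n)" for n
    unfolding a_eq t_def[of "Suc n"] frac_def xS by simp
  have a1: "\<And>j. 1 \<le> j \<Longrightarrow> 1 \<le> ?a j"
    using cf_expansion_cf_quotients[OF irr] by (simp add: is_cf_expansion_def)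
  define q where "q k = real_of_int (cf_D ?a k)" for k
  define p where "p k = real_of_int (cf_N ?a k)" for k
  have qpos: "0 < q k" for k using cf_D_pos[where a = ?a and k = k, OF a1] by (simp add: q_def)
  define e where "e k = \<theta> * q k - p k" for k
  \<comment> \<open>The value 0 at index 0 stands for q_(-1) = 0 and makes the recursion for
    \<open>v\<close> valid from the start.\<close>
  define v where "v k = (if k = 0 then 0 else q (k - 1) / q k)" for k
  have v0: "0 \<le> v k" for k
    using qpos[of k] qpos[of "k - 1"] by (simp add: v_def)
  have q1: "q (Suc 0) = of_int (?a 1)" and q0: "q 0 = 1" by (simp_all add: q_def)
  have qS: "q (Suc (Suc k)) = of_int (?a (Suc (Suc k))) * q (Suc k) + q k" for k
    by (simp add: q_def cf_D_rec del: cf_ND.simps)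
  have pS: "p (Suc (Suc k)) = of_int (?a (Suc (Suc k))) * p (Suc k) + p k" for k
    by (simp add: p_def cf_N_rec del: cf_ND.simps)
  have vS: "v (Suc k) = 1 / (of_int (?a (Suc k)) + v k)" for k
  proof (cases k)
    case (Suc m)
    have "q (Suc k) / q k = of_int (?a (Suc k)) + v k"
      using qpos[of k] unfolding Suc qS by (simp add: v_def add_divide_distrib)
    moreover have "v (Suc k) = 1 / (q (Suc k) / q k)" by (simp add: v_def)
    ultimately show ?thesis by (simp only:)
  qed (simp add: v_def q1 q0)
  have orbit: "(gauss_ext ^^ k) (frac \<theta>, 0) = (t k, v k)" for k
  proof (induction k)
    case 0
    show ?case by (simp add: t_def x0 v_def)
  next
    case (Suc k)
    show ?case unfolding funpow.simps comp_def Suc by (simp add: gauss_ext_def vS a_eq xS t_def)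
  qed
  have e0: "e 0 = t 0"
    by (simp add: e_def q0 p_def t_def x0 a_eq frac_def)
  \<comment> \<open>By the recursion, e_(k+2) = a_(k+2) e_(k+1) + e_k. Eliminating e_k leaves the
    factor a_(k+2) - 1/t_(k+1), which is -t_(k+2).\<close>
  have eS: "e (Suc k) = - t (Suc k) * e k" for k
  proof (induction k)
    case 0
    have p1: "p (Suc 0) = (\<theta> - t 0) * of_int (?a 1) + 1"
      by (simp add: p_def a_eq x0 t_def frac_def)
    have "e (Suc 0) = t 0 * of_int (?a (Suc 0)) - 1"
      by (simp add: e_def q1 p1 algebra_simps)
    then show ?case unfolding aS e0 using tpos[of 0] by (simp add: field_simps)
  next
    case (Suc k)
    have "e (Suc (Suc k)) = of_int (?a (Suc (Suc k))) * e (Suc k) + e k"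
      by (simp add: e_def qS pS algebra_simps)
    also have "e k = - e (Suc k) / t (Suc k)" using Suc tpos[of "Suc k"] by simp
    finally show ?case unfolding aS using tpos[of "Suc k"] by (simp add: field_simps)
  qed
  have "q k * \<bar>e k\<bar> = t k / (1 + t k * v k)"
  proof (induction k)
    case 0
    show ?case using tpos[of 0] by (simp add: q0 e0 v_def)
  next
    case (Suc k)
    have w: "v (Suc k) = q k / q (Suc k)" by (simp add: v_def)
    have r: "q (Suc k) / q k = 1 / t k - t (Suc k) + v k"
    proof -
      have "q (Suc k) / q k = 1 / v (Suc k)" by (simp add: w)
      then show ?thesis unfolding vS aS by simp
    qed
    have "q (Suc k) * \<bar>e (Suc k)\<bar> = t (Suc k) * (q (Suc k) / q k) * (q k * \<bar>e k\<bar>)"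
      using tpos[of "Suc k"] qpos[of k] by (simp add: eS abs_mult)
    also have "\<dots> = t (Suc k) * (q (Suc k) / q k) / (1 / t k + v k)"
    proof -
      have "t k / (1 + t k * v k) = 1 / (1 / t k + v k)"
      proof -
        have "1 / t k + v k = (1 + t k * v k) / t k"
          using tpos[of k] by (simp add: add_divide_distrib)
        then show ?thesis by simp
      qed
      then show ?thesis unfolding Suc by simp
    qed
    also have "1 / t k + v k = q (Suc k) / q k + t (Suc k)" unfolding r by simp
    also have "t (Suc k) * (q (Suc k) / q k) / (q (Suc k) / q k + t (Suc k)) = t (Suc k) / (1 + t (Suc k) * v (Suc k))"
    proof -
      have "x * (y / z) / (y / z + x) = x / (1 + x * (z / y))" if "0 < x" "0 < y" "0 < z" for x y z :: real
        using that by (simp add: divide_simps add_pos_pos)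
      then show ?thesis unfolding w using tpos qpos by blast
    qed
    finally show ?case .
  qed
  then show ?thesis
    unfolding cf_num_denom_eq[OF irr] orbit gauss_height_def by (simp add: e_def q_def p_def)
qed

section \<open>The Gal--Koksma method\<close>

text \<open>Only left halves enter: an initial segment of a dyadic block is a disjoint union of left
  halves, at most one per level, and at most one single term.\<close>

primrec dyadic_energy :: "(nat \<Rightarrow> real) \<Rightarrow> nat \<Rightarrow> nat \<Rightarrow> real" where
  "dyadic_energy y 0 m = (y m)\<^sup>2"
| "dyadic_energy y (Suc r) m =
    (\<Sum>k\<in>{m..<m + 2 ^ r}. y k)\<^sup>2 + dyadic_energy y r m + dyadic_energy y r (m + 2 ^ r)"

lemma dyadic_energy_nonneg: "0 \<le> dyadic_energy y r m"
  by (induction r arbitrary: m) auto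

text \<open>Cauchy-Schwarz with weights 1 and c. Taking c as the factor already paid for b makes the
  constant grow by one per dyadic level instead of doubling.\<close>

lemma square_add_weighted:
  fixes a b c :: real
  assumes "0 < c"
  shows "(a + b)\<^sup>2 \<le> (c + 1) * (a\<^sup>2 + b\<^sup>2 / c)"
proof -
  have "(c + 1) * (a\<^sup>2 + b\<^sup>2 / c) - (a + b)\<^sup>2 = (c * a - b)\<^sup>2 / c"
    using assms by (simp add: power2_eq_square divide_simps) (simp add: algebra_simps)
  also have "\<dots> \<ge> 0" using assms by simp
  finally show ?thesis by simp
qed

lemma partial_sum_square_le_dyadic_energy:
  assumes "n \<le> 2 ^ r"
  shows "(\<Sum>k\<in>{m..<m + n}. y k)\<^sup>2 \<le> (real r + 1) * dyadic_energy y r m"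
  using assms
proof (induction r arbitrary: m n)
  case 0
  then have "n = 0 \<or> n = 1" by auto
  then show ?case by auto
next
  case (Suc r)
  show ?case
  proof (cases "n \<le> 2 ^ r")
    case True
    have "(\<Sum>k\<in>{m..<m + n}. y k)\<^sup>2 \<le> (real r + 1) * dyadic_energy y r m"
      by (rule Suc.IH[OF True])
    also have "\<dots> \<le> (real (Suc r) + 1) * dyadic_energy y (Suc r) m"
      by (intro mult_mono) (auto simp: dyadic_energy_nonneg)
    finally show ?thesis .
  next
    case False
    define A where "A = (\<Sum>k\<in>{m..<m + 2 ^ r}. y k)"
    define B where "B = (\<Sum>k\<in>{m + 2 ^ r..<m + n}. y k)"
    have "{m + 2 ^ r..<m + n} = {m + 2 ^ r..<(m + 2 ^ r) + (n - 2 ^ r)}" using False by simp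
    moreover have "n - 2 ^ r \<le> 2 ^ r" using Suc.prems by simp
    ultimately have B: "B\<^sup>2 \<le> (real r + 1) * dyadic_energy y r (m + 2 ^ r)"
      unfolding B_def using Suc.IH by presburger
    have "(\<Sum>k\<in>{m..<m + n}. y k) = A + B"
      unfolding A_def B_def using False by (intro sum.atLeastLessThan_concat[symmetric]) auto
    then have "(\<Sum>k\<in>{m..<m + n}. y k)\<^sup>2 \<le> (real r + 1 + 1) * (A\<^sup>2 + B\<^sup>2 / (real r + 1))"
      using square_add_weighted[of "real r + 1" A B] by simp
    also have "B\<^sup>2 / (real r + 1) \<le> dyadic_energy y r (m + 2 ^ r)"
      using B by (simp add: divide_le_eq mult.commute)
    then have "(real r + 1 + 1) * (A\<^sup>2 + B\<^sup>2 / (real r + 1)) \<le> (real (Suc r) + 1) * dyadic_energy y (Suc r) m"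
      using dyadic_energy_nonneg[of y r m]
      by (intro mult_mono) (auto simp: A_def)
    finally show ?thesis .
  qed
qed

lemma summable_powr_Suc:
  fixes s :: real
  assumes "s < -1"
  shows "summable (\<lambda>n. (real n + 1) powr s)"
  using summable_Suc_iff[of "\<lambda>n. real n powr s"] assms
  by (simp add: summable_real_powr_iff add.commute)

text \<open>The energy of a block of length 2^r has mean at most C (r+1) 2^r, one term per level.
  Division by \<open>w r\<close> leaves the summable (r+1)^(-1-2\<epsilon>), so almost everywhere
  the energies are O(\<open>w r\<close>). Bounding partial sums by the energy costs one more factor
  of order r. The square thus carries the logarithm to the power 3 + 2\<epsilon>, whence 3/2 +
  \<epsilon>.\<close>

lemma gal_koksma:
  fixes Y :: "nat \<Rightarrow> 'a \<Rightarrow> real" and \<epsilon> C :: real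
  assumes int: "\<And>m n. integrable M (\<lambda>x. (\<Sum>k\<in>{m..<m + n}. Y k x)\<^sup>2)"
    and var: "\<And>m n. (LINT x|M. (\<Sum>k\<in>{m..<m + n}. Y k x)\<^sup>2) \<le> C * real n"
    and \<epsilon>: "0 < \<epsilon>"
  shows "AE x in M. \<exists>K. \<forall>N\<ge>2. \<bar>\<Sum>k=1..N. Y k x\<bar> \<le> K * real N powr (1/2) * ln (real N) powr (3/2 + \<epsilon>)"
proof -
  define T where "T r m x = dyadic_energy (\<lambda>k. Y k x) r m" for r m x
  have T0: "0 \<le> T r m x" for r m x by (simp add: T_def dyadic_energy_nonneg)
  have C0: "0 \<le> C"
  proof -
    have "0 \<le> (LINT x|M. (\<Sum>k\<in>{0..<0 + 1}. Y k x)\<^sup>2)" by (intro Bochner_Integration.integral_nonneg) simp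
    also have "\<dots> \<le> C" using var[of 0 1] by simp
    finally show ?thesis .
  qed
  have Tint: "integrable M (T r m)" and TE: "(LINT x|M. T r m x) \<le> C * ((real r + 1) * 2 ^ r)" for r m
  proof (induction r arbitrary: m)
    case 0
    {
      case 1
      show ?case using int[of m 1] by (simp add: T_def[abs_def])
    next
      case 2
      show ?case using var[of m 1] by (simp add: T_def)
    }
  next
    case (Suc r)
    have eq: "T (Suc r) m = (\<lambda>x. (\<Sum>k\<in>{m..<m + 2 ^ r}. Y k x)\<^sup>2 + T r m x + T r (m + 2 ^ r) x)" for m
      by (rule ext) (simp add: T_def)
    {
      case 1
      show ?case unfolding eq by (intro Bochner_Integration.integrable_add int Suc.IH)
    next
      case 2
      have "(LINT x|M. T (Suc r) m x) = (LINT x|M. (\<Sum>k\<in>{m..<m + 2 ^ r}. Y k x)\<^sup>2)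
          + (LINT x|M. T r m x) + (LINT x|M. T r (m + 2 ^ r) x)"
        unfolding eq by (simp add: int Suc.IH(1))
      also have "\<dots> \<le> C * real (2 ^ r) + C * ((real r + 1) * 2 ^ r) + C * ((real r + 1) * 2 ^ r)"
        by (intro add_mono var Suc.IH)
      also have "\<dots> \<le> C * ((real (Suc r) + 1) * 2 ^ Suc r)"
        using C0 by (simp add: algebra_simps)
      finally show ?case .
    }
  qed
  define w where "w r = 2 ^ r * (real r + 1) powr (2 + 2 * \<epsilon>)" for r
  have w0: "0 < w r" for r by (simp add: w_def)
  define g where "g r x = T r 1 x / w r" for r x
  have g0: "0 \<le> g r x" for r x using T0 w0[of r] by (simp add: g_def)
  have gint: "integrable M (g r)" for r unfolding g_def by (intro integrable_divide Tint)
  have gE: "(LINT x|M. g r x) \<le> C * (real r + 1) powr (-1 - 2 * \<epsilon>)" for r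
  proof -
    have "(LINT x|M. g r x) = (LINT x|M. T r 1 x) / w r" by (simp add: g_def)
    also have "\<dots> \<le> C * ((real r + 1) * 2 ^ r) / w r"
      using TE[of r 1] w0[of r] by (intro divide_right_mono) simp_all
    also have "\<dots> = C * ((real r + 1) powr 1 / (real r + 1) powr (2 + 2 * \<epsilon>))"
      by (simp add: w_def)
    also have "\<dots> = C * (real r + 1) powr (-1 - 2 * \<epsilon>)"
      unfolding powr_diff[symmetric] by simp
    finally show ?thesis .
  qed
  have "(\<integral>\<^sup>+x. (\<Sum>r. ennreal (g r x)) \<partial>M) = (\<Sum>r. \<integral>\<^sup>+x. ennreal (g r x) \<partial>M)"
    using gint by (intro nn_integral_suminf) (auto dest: borel_measurable_integrable)
  also have "\<dots> = (\<Sum>r. ennreal (LINT x|M. g r x))"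
    by (simp add: nn_integral_eq_integral gint g0)
  also have "\<dots> \<le> (\<Sum>r. ennreal (C * (real r + 1) powr (-1 - 2 * \<epsilon>)))"
    by (intro suminf_le ennreal_leI gE) auto
  also have "\<dots> = ennreal (\<Sum>r. C * (real r + 1) powr (-1 - 2 * \<epsilon>))"
    using C0 \<epsilon> by (intro suminf_ennreal2 summable_mult summable_powr_Suc) auto
  also have "\<dots> < \<infinity>" by simp
  finally have fin: "(\<integral>\<^sup>+x. (\<Sum>r. ennreal (g r x)) \<partial>M) \<noteq> \<infinity>" by simp
  have "(\<lambda>x. \<Sum>r. ennreal (g r x)) \<in> borel_measurable M"
    using gint[THEN borel_measurable_integrable] by measurable
  from nn_integral_noteq_infinite[OF this fin]
  show ?thesis
  proof (rule AE_mp, intro AE_I2 impI)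
    fix x assume "(\<Sum>r. ennreal (g r x)) \<noteq> \<infinity>"
    then obtain A where A: "(\<Sum>r. ennreal (g r x)) = ennreal A" "0 \<le> A"
      by (metis ennreal_cases infinity_ennreal_def)
    have gA: "g r x \<le> A" for r
    proof -
      have "ennreal (g r x) \<le> (\<Sum>r. ennreal (g r x))"
        using sum_le_suminf[of "\<lambda>r. ennreal (g r x)" "{r}"] by simp
      then show ?thesis unfolding A(1) using A(2) by (simp add: ennreal_le_iff)
    qed
    \<comment> \<open>Since r >= 1, r + 2 <= 3 r, and r <= ln N / ln 2.\<close>
    define c :: real where "c = 3 / ln 2"
    have c0: "0 < c" by (simp add: c_def)
    define K where "K = sqrt (2 * A * c powr (3 + 2 * \<epsilon>))"
    show "\<exists>K. \<forall>N\<ge>2. \<bar>\<Sum>k=1..N. Y k x\<bar> \<le> K * real N powr (1/2) * ln (real N) powr (3/2 + \<epsilon>)"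
    proof (intro exI[of _ K] allI impI)
      fix N :: nat assume N: "2 \<le> N"
      obtain r where r: "2 ^ r \<le> N" "N < 2 ^ (r + 1)"
        using ex_power_ivl1[of 2 N] N by auto
      have r1: "1 \<le> r" using r(2) N by (cases r) auto
      have lnN: "0 < ln (real N)" using N by simp
      have "real r * ln 2 = ln (2 ^ r)" by (simp add: ln_realpow)
      also have "\<dots> \<le> ln (real N)" using r(1) N
        by (metis ln_mono numeral_power_le_of_nat_cancel_iff of_nat_0_less_iff zero_less_numeral zero_less_power less_le_trans)
      finally have "real r \<le> ln (real N) / ln 2" by (simp add: le_divide_eq)
      then have rc: "real r + 2 \<le> c * ln (real N)" using r1 by (simp add: c_def)
      define S where "S = (\<Sum>k=1..N. Y k x)"
      have "{1..N} = {1..<1 + N}" by auto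
      then have "S\<^sup>2 \<le> (real (Suc r) + 1) * T (Suc r) 1 x"
        using partial_sum_square_le_dyadic_energy[of N "Suc r" "\<lambda>k. Y k x" 1] r(2)
        by (simp add: S_def T_def del: dyadic_energy.simps)
      also have "\<dots> \<le> (real (Suc r) + 1) * (A * w (Suc r))"
        using gA[of "Suc r"] w0[of "Suc r"] by (intro mult_left_mono) (auto simp: g_def divide_le_eq)
      also have "\<dots> = 2 * A * 2 ^ r * ((real r + 2) powr 1 * (real r + 2) powr (2 + 2 * \<epsilon>))"
        by (simp add: w_def add.commute mult_ac)
      also have "\<dots> = 2 * A * 2 ^ r * (real r + 2) powr (3 + 2 * \<epsilon>)"
        unfolding powr_add[symmetric] by simp
      also have "\<dots> \<le> 2 * A * real N * (c * ln (real N)) powr (3 + 2 * \<epsilon>)"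
        using A(2) rc r(1) \<epsilon> by (intro mult_mono powr_mono2) (auto simp flip: of_nat_power)
      also have "\<dots> = (K * real N powr (1/2) * ln (real N) powr (3/2 + \<epsilon>))\<^sup>2"
      proof -
        have "(ln (real N) powr (3/2 + \<epsilon>))\<^sup>2 = ln (real N) powr (3 + 2 * \<epsilon>)"
          by (simp add: power2_eq_square flip: powr_add)
        moreover have "K\<^sup>2 = 2 * A * c powr (3 + 2 * \<epsilon>)" using A(2) by (simp add: K_def)
        moreover have "(real N powr (1/2))\<^sup>2 = real N" using N by (simp add: powr_half_sqrt)
        ultimately show ?thesis
          using c0 lnN by (simp add: power_mult_distrib powr_mult mult_ac)
      qed
      finally have "S\<^sup>2 \<le> (K * real N powr (1/2) * ln (real N) powr (3/2 + \<epsilon>))\<^sup>2" .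
      moreover have "0 \<le> K" using A(2) by (simp add: K_def)
      ultimately show "\<bar>\<Sum>k=1..N. Y k x\<bar> \<le> K * real N powr (1/2) * ln (real N) powr (3/2 + \<epsilon>)"
        unfolding S_def[symmetric] by (metis abs_le_square_iff abs_of_nonneg mult_nonneg_nonneg powr_ge_zero)
    qed
  qed
qed

section \<open>Conditional distributions along the Gauss map\<close>

lemma set_integrable_bounded_interval:
  fixes f :: "real \<Rightarrow> real"
  assumes "f \<in> borel_measurable borel" "\<And>x. x \<in> {a..b} \<Longrightarrow> \<bar>f x\<bar> \<le> B"
  shows "set_integrable lborel {a..b} f"
  unfolding set_integrable_def using assms
  by (intro integrableI_bounded_set_indicator[where B = B]) (auto simp: emeasure_lborel_Icc_eq)

lemma abs_set_integral_le_interval: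
  fixes f :: "real \<Rightarrow> real"
  assumes [measurable]: "f \<in> borel_measurable borel" and bd: "\<And>x. x \<in> {a..b} \<Longrightarrow> \<bar>f x\<bar> \<le> B" and "a \<le> b"
  shows "\<bar>LBINT x:{a..b}. f x\<bar> \<le> B * (b - a)"
proof -
  have "\<bar>LBINT x:{a..b}. f x\<bar> \<le> (LBINT x:{a..b}. \<bar>f x\<bar>)"
    using set_integral_norm_bound[OF set_integrable_bounded_interval[of f a b B]] bd by simp
  also have "\<dots> \<le> (LBINT x:{a..b}. B)"
    by (intro set_integral_mono set_integrable_bounded_interval[of _ a b B] set_integrable_bounded_interval[of _ a b "\<bar>B\<bar>"])
      (use bd in auto)
  also have "\<dots> = B * (b - a)"
    using \<open>a \<le> b\<close> by (simp add: set_lebesgue_integral_def)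
  finally show ?thesis .
qed

lemma set_integral_cong_Ioo:
  fixes f g :: "real \<Rightarrow> real"
  assumes [measurable]: "f \<in> borel_measurable borel" "g \<in> borel_measurable borel"
    and eq: "\<And>x. a < x \<Longrightarrow> x < b \<Longrightarrow> f x = g x"
  shows "(LBINT x:{a..b}. f x) = (LBINT x:{a..b}. g x)"
proof (rule set_lebesgue_integral_cong_AE)
  have "AE x in lborel. x \<notin> {a, b}"
    by (intro AE_not_in null_setsI) (auto simp: emeasure_lborel_countable)
  then show "AE x\<in>{a..b} in lborel. f x = g x"
    by eventually_elim (use eq in force)
qed auto

lemma set_integral_substitution:
  fixes f g g' :: "real \<Rightarrow> real"
  assumes "set_integrable lborel {g a..g b} f"
    and "\<And>x. x \<in> {a..b} \<Longrightarrow> (g has_real_derivative g' x) (at x)"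
    and "continuous_on {a..b} g'"
    and "\<And>x. x \<in> {a..b} \<Longrightarrow> g' x \<ge> 0"
    and "a \<le> b"
  shows "(LBINT x:{g a..g b}. f x) = (LBINT x:{a..b}. f (g x) * g' x)"
  using integral_substitution(2)[OF assms] by (simp add: set_lebesgue_integral_def mult_ac)

lemma set_integral_gauss_branch:
  fixes f :: "real \<Rightarrow> real"
  assumes "set_integrable lborel {1 / (c + 1)..1 / c} f" and c: "0 < c"
  shows "(LBINT t:{1 / (c + 1)..1 / c}. f t) = (LBINT s:{0..1}. f (1 / (c + s)) / (c + s)\<^sup>2)"
proof -
  \<comment> \<open>The branch s -> 1/(c+s) is decreasing, while
    \<open>set_integral_substitution\<close> takes a map with nonnegative derivative; the reflection
    x = 1 - s mediates.\<close>
  let ?g = "\<lambda>x. 1 / (c + 1 - x)" and ?g' = "\<lambda>x. 1 / (c + 1 - x)\<^sup>2"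
  have "(LBINT t:{?g 0..?g 1}. f t) = (LBINT x:{0..1}. f (?g x) * ?g' x)"
  proof (rule set_integral_substitution)
    show "(?g has_real_derivative ?g' x) (at x)" if "x \<in> {0..1}" for x
      using that c by (auto intro!: derivative_eq_intros simp: power2_eq_square)
    show "continuous_on {0..1} ?g'" using c by (intro continuous_intros) auto
  qed (use assms in auto)
  also have "\<dots> = (LBINT x. indicator {0..1} (1 + -1 * x) *\<^sub>R (f (?g (1 + -1 * x)) * ?g' (1 + -1 * x)))"
    unfolding set_lebesgue_integral_def by (subst lborel_integral_real_affine[where c = "-1" and t = 1]) simp_all
  also have "\<dots> = (LBINT s:{0..1}. f (1 / (c + s)) / (c + s)\<^sup>2)"
    unfolding set_lebesgue_integral_def by (intro Bochner_Integration.integral_cong) (auto simp: indicator_def)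
  finally show ?thesis by simp
qed

text \<open>The i-th branch covers [1/(i+2), 1/(i+1)]. After n branches the integral over
  [0, 1/(n+1)] is left, which is at most B/(n+1).\<close>

lemma gauss_branches_sums:
  fixes f :: "real \<Rightarrow> real"
  assumes [measurable]: "f \<in> borel_measurable borel" and bd: "\<And>x. x \<in> {0..1} \<Longrightarrow> \<bar>f x\<bar> \<le> B"
  shows "(\<lambda>i. LBINT s:{0..1}. f (1 / (real i + 1 + s)) / (real i + 1 + s)\<^sup>2) sums (LBINT t:{0..1}. f t)"
proof -
  define a where "a i = (LBINT s:{0..1}. f (1 / (real i + 1 + s)) / (real i + 1 + s)\<^sup>2)" for i :: nat
  have rem: "(LBINT t:{0..1}. f t) = (\<Sum>i<n. a i) + (LBINT t:{0..1 / (real n + 1)}. f t)" for n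
  proof (induction n)
    case (Suc n)
    define c where "c = real n + 1"
    have c: "0 < c" "1 \<le> c" by (simp_all add: c_def)
    have le: "0 \<le> 1 / (c + 1)" "1 / (c + 1) \<le> 1 / c" "1 / c \<le> 1"
      using c by (auto intro!: divide_left_mono)
    have bd': "\<bar>f x\<bar> \<le> B" if "0 \<le> x" "x \<le> 1 / c" for x
      using bd[of x] that le by auto
    have i1: "set_integrable lborel {0..1 / (c + 1)} f"
      by (intro set_integrable_bounded_interval[where B = B] bd') (use le in \<open>auto simp del: divide_le_eq_1\<close>)
    have i2: "set_integrable lborel {1 / (c + 1)..1 / c} f"
    proof (intro set_integrable_bounded_interval[where B = B] bd')
      fix x assume "x \<in> {1 / (c + 1)..1 / c}"
      then show "0 \<le> x" "x \<le> 1 / c" using le(1) by (auto simp only: atLeastAtMost_iff dest: order_trans)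
    qed simp
    have "AE x in lborel. x \<noteq> 1 / (c + 1)" by (rule AE_lborel_singleton)
    then have ae: "AE x in lborel. \<not> (x \<in> {0..1 / (c + 1)} \<and> x \<in> {1 / (c + 1)..1 / c})"
      by eventually_elim auto
    have un: "{0..1 / c} = {0..1 / (c + 1)} \<union> {1 / (c + 1)..1 / c}"
      using le by (intro ivl_disj_un_two_touch(4)[symmetric]) auto
    have "(LBINT t:{0..1 / c}. f t) = (LBINT t:{0..1 / (c + 1)}. f t) + (LBINT t:{1 / (c + 1)..1 / c}. f t)"
      unfolding un by (rule set_integral_Un_AE[OF ae _ _ i1 i2]) simp_all
    also have "(LBINT t:{1 / (c + 1)..1 / c}. f t) = a n"
      unfolding a_def c_def[symmetric] by (rule set_integral_gauss_branch[OF i2 c(1)])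
    finally show ?case using Suc by (simp add: c_def)
  qed simp
  have "(\<lambda>n. (LBINT t:{0..1}. f t) - (\<Sum>i<n. a i)) \<longlonglongrightarrow> 0"
  proof (rule Lim_null_comparison)
    show "\<forall>\<^sub>F n in sequentially. norm ((LBINT t:{0..1}. f t) - (\<Sum>i<n. a i)) \<le> B * (1 / (real n + 1))"
    proof (intro always_eventually allI)
      fix n :: nat
      have le1: "1 / (real n + 1) \<le> 1" by simp
      have "\<bar>LBINT t:{0..1 / (real n + 1)}. f t\<bar> \<le> B * (1 / (real n + 1) - 0)"
        by (intro abs_set_integral_le_interval bd) (auto intro: order_trans[OF _ le1])
      then show "norm ((LBINT t:{0..1}. f t) - (\<Sum>i<n. a i)) \<le> B * (1 / (real n + 1))"
        unfolding rem[of n] by simp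
    qed
    show "(\<lambda>n. B * (1 / (real n + 1))) \<longlonglongrightarrow> 0"
      using tendsto_mult[OF tendsto_const[of B] LIMSEQ_inverse_real_of_nat]
      by (simp add: inverse_eq_divide add.commute)
  qed
  then have "(\<lambda>n. (LBINT t:{0..1}. f t) - ((LBINT t:{0..1}. f t) - (\<Sum>i<n. a i))) \<longlonglongrightarrow> (LBINT t:{0..1}. f t) - 0"
    by (intro tendsto_diff tendsto_const)
  then show ?thesis unfolding sums_def a_def by simp
qed

text \<open>Given the partial quotients \<open>a\<^sub>1, \<dots>, a\<^sub>k\<close> of a uniformly distributed number, the \<open>k\<close>-th iterate
  of the Gauss map has density \<open>cond_density v\<close> with \<open>v = q\<^sub>k\<^sub>-\<^sub>1 / q\<^sub>k\<close>, and \<open>digit_prob i v\<close> is the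
  conditional probability of \<open>a\<^sub>k\<^sub>+\<^sub>1 = i + 1\<close>.\<close>

definition cond_density :: "real \<Rightarrow> real \<Rightarrow> real" where
  "cond_density v t = (1 + v) / (1 + v * t)\<^sup>2"

definition cond_expect :: "real \<Rightarrow> (real \<Rightarrow> real) \<Rightarrow> real" where
  "cond_expect v \<Phi> = (LBINT t:{0..1}. \<Phi> t * cond_density v t)"

definition digit_prob :: "nat \<Rightarrow> real \<Rightarrow> real" where
  "digit_prob i v = (1 + v) / ((real i + 1 + v) * (real i + 2 + v))"

lemma cond_density_measurable [measurable]: "cond_density v \<in> borel_measurable borel"
  unfolding cond_density_def by measurable

lemma cond_density_bounds:
  assumes "0 \<le> v" "v \<le> 1" "0 \<le> t"
  shows "0 \<le> cond_density v t" "cond_density v t \<le> 2"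
proof -
  have "1 \<le> 1 + v * t" using assms by simp
  then have "1 \<le> (1 + v * t)\<^sup>2" by (rule one_le_power)
  moreover from this have "2 * 1 \<le> 2 * (1 + v * t)\<^sup>2" by (intro mult_left_mono) auto
  then have "1 + v \<le> 2 * (1 + v * t)\<^sup>2" using assms by linarith
  ultimately show "0 \<le> cond_density v t" "cond_density v t \<le> 2"
    using assms unfolding cond_density_def by (auto simp: divide_le_eq)
qed

lemma cond_density_mult_bound:
  assumes "0 \<le> v" "v \<le> 1" "t \<in> {0..1}" "\<bar>y\<bar> \<le> B"
  shows "\<bar>y * cond_density v t\<bar> \<le> B * 2"
  unfolding abs_mult using assms cond_density_bounds[of v t] by (intro mult_mono) auto

lemma cond_expect_integrable:
  assumes "\<Phi> \<in> borel_measurable borel" "\<And>t. t \<in> {0..1} \<Longrightarrow> \<bar>\<Phi> t\<bar> \<le> B" "0 \<le> v" "v \<le> 1"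
  shows "set_integrable lborel {0..1} (\<lambda>t. \<Phi> t * cond_density v t)"
  using assms by (intro set_integrable_bounded_interval[where B = "B * 2"] cond_density_mult_bound) auto

lemma abs_cond_expect_le:
  assumes "\<Phi> \<in> borel_measurable borel" "\<And>t. t \<in> {0..1} \<Longrightarrow> \<bar>\<Phi> t\<bar> \<le> B" "0 \<le> v" "v \<le> 1"
  shows "\<bar>cond_expect v \<Phi>\<bar> \<le> 2 * B"
  using abs_set_integral_le_interval[of "\<lambda>t. \<Phi> t * cond_density v t" 0 1 "B * 2"]
    cond_density_mult_bound[of v] assms by (simp add: cond_expect_def mult.commute)

lemma cond_expect_cong:
  assumes "\<Phi> \<in> borel_measurable borel" "\<Psi> \<in> borel_measurable borel"
    and "\<And>t. 0 < t \<Longrightarrow> t < 1 \<Longrightarrow> \<Phi> t = \<Psi> t"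
  shows "cond_expect v \<Phi> = cond_expect v \<Psi>"
  unfolding cond_expect_def using assms by (intro set_integral_cong_Ioo) auto

text \<open>The Markov property in analytic form: along one branch the density stays in the same
  one-parameter family, with v replaced by 1/(i+1+v) and the digit probability split off.\<close>

lemma cond_density_branch:
  assumes "0 \<le> v" "0 \<le> s"
  shows "cond_density v (1 / (real i + 1 + s)) / (real i + 1 + s)\<^sup>2 =
    digit_prob i v * cond_density (1 / (real i + 1 + v)) s"
proof -
  define c where "c = real i + 1"
  have c: "0 < c" by (simp add: c_def)
  have p: "0 < c + s" "0 < c + v" "0 < c + v + 1" "0 < c + v + s" using c assms by linarith+
  have 1: "1 + v * (1 / (c + s)) = (c + v + s) / (c + s)" using p by (simp add: field_simps)
  have 2: "1 + 1 / (c + v) * s = (c + v + s) / (c + v)" using p by (simp add: field_simps)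
  have 3: "1 + 1 / (c + v) = (c + v + 1) / (c + v)" using p by (simp add: field_simps)
  have "cond_density v (1 / (c + s)) / (c + s)\<^sup>2 = (1 + v) / (c + v + s)\<^sup>2"
    unfolding cond_density_def 1 using p by (simp add: power_divide)
  moreover have "digit_prob i v * cond_density (1 / (c + v)) s = (1 + v) / (c + v + s)\<^sup>2"
    unfolding cond_density_def 2 3 digit_prob_def using p
    by (simp add: power_divide c_def[symmetric] add_ac) (simp add: power2_eq_square c_def add_ac)
  ultimately show ?thesis by (simp add: c_def)
qed

text \<open>The law of total expectation over the next partial quotient; iterating it replaces
  conditioning on a longer initial string.\<close>

lemma cond_expect_step:
  assumes [measurable]: "\<Phi> \<in> borel_measurable borel"
    and bd: "\<And>t. t \<in> {0..1} \<Longrightarrow> \<bar>\<Phi> t\<bar> \<le> B" and v: "0 \<le> v" "v \<le> 1"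
  shows "(\<lambda>i. digit_prob i v * cond_expect (1 / (real i + 1 + v)) (\<lambda>s. \<Phi> (1 / (real i + 1 + s))))
    sums cond_expect v \<Phi>"
proof -
  have "(\<lambda>i. LBINT s:{0..1}. \<Phi> (1 / (real i + 1 + s)) * cond_density v (1 / (real i + 1 + s)) / (real i + 1 + s)\<^sup>2)
      sums (LBINT t:{0..1}. \<Phi> t * cond_density v t)"
    using gauss_branches_sums[of "\<lambda>t. \<Phi> t * cond_density v t" "B * 2"] cond_density_mult_bound[OF v _ bd]
    by simp
  moreover have "(LBINT s:{0..1}. \<Phi> (1 / (real i + 1 + s)) * cond_density v (1 / (real i + 1 + s)) / (real i + 1 + s)\<^sup>2)
      = digit_prob i v * cond_expect (1 / (real i + 1 + v)) (\<lambda>s. \<Phi> (1 / (real i + 1 + s)))" for i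
    unfolding cond_expect_def set_integral_mult_right[symmetric]
    by (intro set_lebesgue_integral_cong ballI impI allI)
      (auto simp: cond_density_branch[OF v(1)] mult_ac simp flip: times_divide_eq_right)
  ultimately show ?thesis unfolding cond_expect_def by simp
qed

text \<open>The conditional probability that the next partial quotient exceeds i.\<close>

definition digit_tail :: "nat \<Rightarrow> real \<Rightarrow> real" where
  "digit_tail i v = (1 + v) / (real i + 1 + v)"

lemma digit_tail_0: "0 \<le> v \<Longrightarrow> digit_tail 0 v = 1"
  by (simp add: digit_tail_def)

lemma digit_prob_eq_tail_diff:
  assumes "0 \<le> v"
  shows "digit_prob i v = digit_tail i v - digit_tail (Suc i) v"
proof -
  have "0 < real i + 1 + v" "0 < real i + 2 + v" using assms by linarith+
  then show ?thesis unfolding digit_prob_def digit_tail_def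
    by (simp add: divide_simps) (simp add: algebra_simps)
qed

lemma digit_prob_nonneg: "0 \<le> v \<Longrightarrow> 0 \<le> digit_prob i v"
  by (simp add: digit_prob_def)

lemma digit_tail_tendsto:
  assumes "0 \<le> v"
  shows "(\<lambda>i. digit_tail i v) \<longlonglongrightarrow> 0"
  unfolding digit_tail_def
  by real_asymp

lemma sum_digit_prob: "0 \<le> v \<Longrightarrow> (\<Sum>i<n. digit_prob i v) = 1 - digit_tail n v"
  by (induction n) (auto simp: digit_prob_eq_tail_diff digit_tail_0)

lemma digit_prob_sums: "0 \<le> v \<Longrightarrow> (\<lambda>i. digit_prob i v) sums 1"
  unfolding sums_def using tendsto_diff[OF tendsto_const[of 1] digit_tail_tendsto[of v]]
  by (simp add: sum_digit_prob)

lemma abs_average_le: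
  assumes v: "0 \<le> v" and s: "(\<lambda>i. digit_prob i v * a i) sums S" and a: "\<And>i. \<bar>a i\<bar> \<le> D"
  shows "\<bar>S\<bar> \<le> D"
proof -
  have D: "(\<lambda>i. digit_prob i v * D) sums D" using sums_mult2[OF digit_prob_sums[OF v], of D] by simp
  have "S \<le> D"
  proof (rule sums_le[OF _ s D])
    show "digit_prob i v * a i \<le> digit_prob i v * D" for i
      using a[of i] by (intro mult_left_mono digit_prob_nonneg v) linarith
  qed
  moreover have "- D \<le> S"
  proof (rule sums_le[OF _ sums_minus[OF D] s])
    show "- (digit_prob i v * D) \<le> digit_prob i v * a i" for i
      using mult_left_mono[OF _ digit_prob_nonneg[OF v], of "- D" "a i" i] a[of i] by simp
  qed
  ultimately show ?thesis by linarith
qed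

section \<open>Contraction of the transition operator\<close>

lemma digit_branch_bounds:
  assumes "0 \<le> (v::real)"
  shows "0 \<le> 1 / (real i + 1 + v)" "1 / (real i + 1 + v) \<le> 1"
  using assms by auto

lemma digit_tail_diff:
  assumes "0 \<le> x" "0 \<le> y"
  shows "digit_tail i x - digit_tail i y = (x - y) * real i / ((real i + 1 + x) * (real i + 1 + y))"
proof -
  have "0 < real i + 1 + x" "0 < real i + 1 + y" using assms by linarith+
  then show ?thesis unfolding digit_tail_def
    by (simp add: divide_simps) (simp add: algebra_simps)
qed

text \<open>For differences of tails the boundary term at 0 vanishes because every
  \<open>digit_tail 0\<close> is 1.\<close>

lemma sum_by_parts_tail:
  fixes d f :: "nat \<Rightarrow> real"
  assumes "d 0 = 0"
  shows "(\<Sum>i<n. (d i - d (Suc i)) * f i) = (\<Sum>i<n. d (Suc i) * (f (Suc i) - f i)) - d n * f n"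
  using assms by (induction n) (auto simp: algebra_simps)

text \<open>Comparison of c^3 with (c-1) c (c+1), whose reciprocals telescope; the induction carries
  the telescoped remainder.\<close>

lemma sum_inverse_cubes_le: "(\<Sum>i<n. 1 / (real i + 2) ^ 3) \<le> 1 / 4"
proof -
  have "(\<Sum>i<n. 1 / (real i + 2) ^ 3) \<le> 1 / 4 - 1 / (2 * (real n + 1) * (real n + 2))"
  proof (induction n)
    case (Suc n)
    define c where "c = real n + 2"
    have c: "2 \<le> c" by (simp add: c_def)
    have "1 / c ^ 3 \<le> 1 / ((c - 1) * c * (c + 1))"
    proof (rule divide_left_mono)
      show "(c - 1) * c * (c + 1) \<le> c ^ 3" using c by (simp add: power3_eq_cube algebra_simps)
    qed (use c in auto)
    also have "\<dots> = 1 / (2 * (c - 1) * c) - 1 / (2 * c * (c + 1))"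
      using c by (simp add: divide_simps)
    finally show ?case using Suc by (simp add: c_def add.commute)
  qed simp
  also have "\<dots> \<le> 1 / 4" by simp
  finally show ?thesis .
qed

text \<open>The digit 1 has probability at most 1/2 and denominator at least 1. All other digits
  have total probability at most 2/3 and denominators at least 4. Together 1/2 + 1/6 = 2/3.\<close>

lemma sum_digit_prob_contraction_le:
  assumes "0 \<le> x" "x \<le> 1" "0 \<le> y"
  shows "(\<Sum>i<n. digit_prob i x / ((real i + 1 + x) * (real i + 1 + y))) \<le> 2 / 3"
proof -
  have first: "digit_prob 0 x / ((1 + x) * (1 + y)) \<le> 1 / 2"
  proof -
    have "digit_prob 0 x \<le> 1 / 2" using assms by (simp add: digit_prob_def divide_le_eq)
    moreover have "1 \<le> (1 + x) * (1 + y)" using mult_mono[of 1 "1 + x" 1 "1 + y"] assms by simp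
    ultimately show ?thesis
      using frac_le[of "1/2" "digit_prob 0 x" 1 "(1 + x) * (1 + y)"] by simp
  qed
  have "(\<Sum>i<Suc n. digit_prob i x / ((real i + 1 + x) * (real i + 1 + y)))
      \<le> 1 / 2 + (digit_tail 1 x - digit_tail (Suc n) x) / 4" for n
  proof (induction n)
    case 0
    then show ?case using first by simp
  next
    case (Suc n)
    have "digit_prob (Suc n) x / ((real (Suc n) + 1 + x) * (real (Suc n) + 1 + y)) \<le> digit_prob (Suc n) x / (2 * 2)"
      using assms by (intro divide_left_mono mult_mono digit_prob_nonneg) auto
    also have "\<dots> = (digit_tail (Suc n) x - digit_tail (Suc (Suc n)) x) / 4"
      by (simp add: digit_prob_eq_tail_diff assms)
    finally show ?case using Suc by (simp only: sum.lessThan_Suc) argo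
  qed
  note * = this
  show ?thesis
  proof (cases n)
    case (Suc m)
    have "digit_tail 1 x \<le> 2 / 3" "0 \<le> digit_tail n x"
      using assms by (auto simp: digit_tail_def divide_le_eq)
    then show ?thesis using *[of m] unfolding Suc by argo
  qed simp
qed

text \<open>The factor is \<open>2/3 + 1/4\<close>: the first part comes from moving the branches, the second from
  moving the probabilities, which is estimated by summation by parts.\<close>

lemma average_contraction:
  fixes h :: "real \<Rightarrow> real"
  assumes lip: "\<And>a b. a \<in> {0..1} \<Longrightarrow> b \<in> {0..1} \<Longrightarrow> \<bar>h a - h b\<bar> \<le> K * \<bar>a - b\<bar>"
    and x: "x \<in> {0..1}" and y: "y \<in> {0..1}"
    and Lx: "(\<lambda>i. digit_prob i x * h (1 / (real i + 1 + x))) sums Lx"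
    and Ly: "(\<lambda>i. digit_prob i y * h (1 / (real i + 1 + y))) sums Ly"
  shows "\<bar>Lx - Ly\<bar> \<le> 11 / 12 * K * \<bar>x - y\<bar>"
proof -
  have x0: "0 \<le> x" and y0: "0 \<le> y" using x y by auto
  have K0: "0 \<le> K" using lip[of 0 1] by simp
  define B where "B = \<bar>h 0\<bar> + K"
  define u where "u i = 1 / (real i + 1 + x)" for i :: nat
  define w where "w i = 1 / (real i + 1 + y)" for i :: nat
  have u: "u i \<in> {0..1}" and w: "w i \<in> {0..1}" for i
    using digit_branch_bounds[OF x0] digit_branch_bounds[OF y0] by (simp_all add: u_def w_def)
  have hB: "\<bar>h (w i)\<bar> \<le> B" for i
  proof -
    have "\<bar>h (w i) - h 0\<bar> \<le> K * \<bar>w i - 0\<bar>" by (rule lip) (use w in auto)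
    also have "\<dots> \<le> K * 1" using w[of i] K0 by (intro mult_left_mono) auto
    finally show ?thesis unfolding B_def by linarith
  qed
  define d where "d i = digit_tail i x - digit_tail i y" for i
  define P where "P n = (\<Sum>i<n. digit_prob i x * h (u i)) - (\<Sum>i<n. digit_prob i y * h (w i))" for n
  \<comment> \<open>Splitting at \<open>digit_prob i x * h (w i)\<close> lets the first sum move
    only branch points and the second only weights. By parts, the second pairs \<open>d\<close>, of
    order |x - y|/i, with increments of h between adjacent branch points, of order K/i^2, so it
    converges.\<close>
  have P: "P n = (\<Sum>i<n. digit_prob i x * (h (u i) - h (w i)))
      + (\<Sum>i<n. d (Suc i) * (h (w (Suc i)) - h (w i))) - d n * h (w n)" for n
  proof -
    have "P n = (\<Sum>i<n. digit_prob i x * (h (u i) - h (w i))) + (\<Sum>i<n. (d i - d (Suc i)) * h (w i))"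
      unfolding P_def sum_subtractf[symmetric] sum.distrib[symmetric]
      by (intro sum.cong refl) (simp add: digit_prob_eq_tail_diff x0 y0 d_def algebra_simps)
    also have "(\<Sum>i<n. (d i - d (Suc i)) * h (w i)) = (\<Sum>i<n. d (Suc i) * (h (w (Suc i)) - h (w i))) - d n * h (w n)"
      by (rule sum_by_parts_tail) (simp add: d_def digit_tail_0 x0 y0)
    finally show ?thesis by simp
  qed
  have 1: "\<bar>\<Sum>i<n. digit_prob i x * (h (u i) - h (w i))\<bar> \<le> 2 / 3 * (K * \<bar>x - y\<bar>)" for n
  proof -
    have "\<bar>\<Sum>i<n. digit_prob i x * (h (u i) - h (w i))\<bar> \<le> (\<Sum>i<n. \<bar>digit_prob i x * (h (u i) - h (w i))\<bar>)"
      by (rule sum_abs)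
    also have "\<dots> \<le> (\<Sum>i<n. digit_prob i x / ((real i + 1 + x) * (real i + 1 + y)) * (K * \<bar>x - y\<bar>))"
    proof (intro sum_mono)
      fix i
      have p: "0 < real i + 1 + x" "0 < real i + 1 + y" using x0 y0 by linarith+
      have "u i - w i = (y - x) / ((real i + 1 + x) * (real i + 1 + y))"
        using p unfolding u_def w_def by (simp add: diff_frac_eq)
      then have "\<bar>u i - w i\<bar> = \<bar>x - y\<bar> / ((real i + 1 + x) * (real i + 1 + y))"
        using p by (simp add: abs_mult abs_minus_commute)
      then have "\<bar>h (u i) - h (w i)\<bar> \<le> K * (\<bar>x - y\<bar> / ((real i + 1 + x) * (real i + 1 + y)))"
        using lip[OF u w] by metis
      then have "digit_prob i x * \<bar>h (u i) - h (w i)\<bar> \<le> digit_prob i x * (K * (\<bar>x - y\<bar> / ((real i + 1 + x) * (real i + 1 + y))))"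
        by (intro mult_left_mono digit_prob_nonneg x0)
      then show "\<bar>digit_prob i x * (h (u i) - h (w i))\<bar>
          \<le> digit_prob i x / ((real i + 1 + x) * (real i + 1 + y)) * (K * \<bar>x - y\<bar>)"
        using digit_prob_nonneg[OF x0, of i] by (simp add: abs_mult mult_ac)
    qed
    also have "\<dots> \<le> 2 / 3 * (K * \<bar>x - y\<bar>)"
      unfolding sum_distrib_right[symmetric]
      using K0 x y by (intro mult_right_mono sum_digit_prob_contraction_le) auto
    finally show ?thesis .
  qed
  have 2: "\<bar>\<Sum>i<n. d (Suc i) * (h (w (Suc i)) - h (w i))\<bar> \<le> 1 / 4 * (K * \<bar>x - y\<bar>)" for n
  proof -
    have "\<bar>\<Sum>i<n. d (Suc i) * (h (w (Suc i)) - h (w i))\<bar> \<le> (\<Sum>i<n. \<bar>d (Suc i) * (h (w (Suc i)) - h (w i))\<bar>)"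
      by (rule sum_abs)
    also have "\<dots> \<le> (\<Sum>i<n. 1 / (real i + 2) ^ 3 * (K * \<bar>x - y\<bar>))"
    proof (intro sum_mono)
      fix i
      define c where "c = real i + 2"
      have c: "2 \<le> c" by (simp add: c_def)
      have "\<bar>d (Suc i)\<bar> = \<bar>x - y\<bar> * ((c - 1) / ((c + x) * (c + y)))"
        using x0 y0 c unfolding d_def digit_tail_diff[OF x0 y0] by (simp add: abs_mult c_def add_ac)
      also have "\<dots> \<le> \<bar>x - y\<bar> * ((c - 1) / (c * c))"
        using c x0 y0 by (intro mult_left_mono divide_left_mono mult_mono) auto
      finally have dle: "\<bar>d (Suc i)\<bar> \<le> \<bar>x - y\<bar> * ((c - 1) / (c * c))" .
      have "\<bar>w (Suc i) - w i\<bar> = 1 / ((c + y) * (c - 1 + y))"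
      proof -
        have "w (Suc i) - w i = 1 / (c + y) - 1 / (c - 1 + y)" by (simp add: w_def c_def add_ac)
        also have "\<dots> = - (1 / ((c + y) * (c - 1 + y)))" using c y0 by (simp add: diff_frac_eq)
        finally show ?thesis using c y0 by simp
      qed
      also have "\<dots> \<le> 1 / (c * (c - 1))"
        using c y0 by (intro divide_left_mono mult_mono) auto
      finally have wle: "\<bar>w (Suc i) - w i\<bar> \<le> 1 / (c * (c - 1))" .
      have "\<bar>h (w (Suc i)) - h (w i)\<bar> \<le> K * \<bar>w (Suc i) - w i\<bar>" by (intro lip w)
      also have "\<dots> \<le> K * (1 / (c * (c - 1)))" using K0 wle by (intro mult_left_mono)
      finally have "\<bar>d (Suc i)\<bar> * \<bar>h (w (Suc i)) - h (w i)\<bar> \<le> (\<bar>x - y\<bar> * ((c - 1) / (c * c))) * (K * (1 / (c * (c - 1))))"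
        using c dle by (intro mult_mono) auto
      also have "\<dots> = 1 / c ^ 3 * (K * \<bar>x - y\<bar>)"
        using c by (simp add: power3_eq_cube mult_ac)
      finally show "\<bar>d (Suc i) * (h (w (Suc i)) - h (w i))\<bar> \<le> 1 / (real i + 2) ^ 3 * (K * \<bar>x - y\<bar>)"
        by (simp only: abs_mult c_def)
    qed
    also have "\<dots> \<le> 1 / 4 * (K * \<bar>x - y\<bar>)"
      unfolding sum_distrib_right[symmetric]
      using K0 by (intro mult_right_mono sum_inverse_cubes_le) auto
    finally show ?thesis .
  qed
  have "\<bar>P n\<bar> \<le> 11 / 12 * (K * \<bar>x - y\<bar>) + \<bar>d n\<bar> * B" for n
  proof -
    have "\<bar>d n * h (w n)\<bar> \<le> \<bar>d n\<bar> * B" using hB[of n] by (simp add: abs_mult mult_left_mono)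
    then show ?thesis using 1[of n] 2[of n] unfolding P by argo
  qed
  moreover have "(\<lambda>n. \<bar>P n\<bar>) \<longlonglongrightarrow> \<bar>Lx - Ly\<bar>"
    using Lx Ly unfolding P_def u_def w_def sums_def by (intro tendsto_intros)
  \<comment> \<open>The boundary term of the summation by parts disappears in the limit, since both
    tails tend to 0.\<close>
  moreover have "(\<lambda>n. 11 / 12 * (K * \<bar>x - y\<bar>) + \<bar>d n\<bar> * B) \<longlonglongrightarrow> 11 / 12 * (K * \<bar>x - y\<bar>) + \<bar>0 - 0\<bar> * B"
    unfolding d_def using digit_tail_tendsto[OF x0] digit_tail_tendsto[OF y0] by (intro tendsto_intros)
  ultimately have "\<bar>Lx - Ly\<bar> \<le> 11 / 12 * (K * \<bar>x - y\<bar>) + \<bar>0 - 0\<bar> * B"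
    by (intro LIMSEQ_le) auto
  then show ?thesis by simp
qed

text \<open>The factor 1+v in \<open>digit_prob\<close> cancels against the weight and leaves
  1/(c(c+1)) with c = i+1+v. This equals the Gauss weight at the branch point 1/c times the Jacobian
  1/c^2, so integrating termwise reassembles the integral of h from its branches.\<close>

lemma gauss_mean_invariant:
  fixes h Lh :: "real \<Rightarrow> real"
  assumes [measurable]: "h \<in> borel_measurable borel" "Lh \<in> borel_measurable borel"
    and bd: "\<And>x. x \<in> {0..1} \<Longrightarrow> \<bar>h x\<bar> \<le> B"
    and s: "\<And>v. v \<in> {0..1} \<Longrightarrow> (\<lambda>i. digit_prob i v * h (1 / (real i + 1 + v))) sums Lh v"
  shows "(LBINT v:{0..1}. Lh v / (1 + v)) = (LBINT v:{0..1}. h v / (1 + v))"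
proof -
  define k where "k i v = digit_prob i v * h (1 / (real i + 1 + v)) / (1 + v)" for i v
  have [measurable]: "k i \<in> borel_measurable borel" for i
    unfolding k_def digit_prob_def by measurable
  have B0: "0 \<le> B" using bd[of 0] by simp
  \<comment> \<open>Partial sums of the digit probabilities are at most 1, so the constant B
    dominates all partial sums at once.\<close>
  have sumbd: "\<bar>\<Sum>i<n. k i v\<bar> \<le> B" if v: "v \<in> {0..1}" for n v
  proof -
    have "\<bar>\<Sum>i<n. k i v\<bar> \<le> (\<Sum>i<n. digit_prob i v * B)"
    proof (intro order_trans[OF sum_abs] sum_mono)
      fix i
      have "\<bar>h (1 / (real i + 1 + v))\<bar> \<le> B" using v by (intro bd) (auto)
      moreover have "\<bar>h (1 / (real i + 1 + v))\<bar> / (1 + v) \<le> \<bar>h (1 / (real i + 1 + v))\<bar> / 1"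
        using v by (intro divide_left_mono) auto
      ultimately have "digit_prob i v * (\<bar>h (1 / (real i + 1 + v))\<bar> / (1 + v)) \<le> digit_prob i v * B"
        using v by (intro mult_left_mono digit_prob_nonneg) auto
      then show "\<bar>k i v\<bar> \<le> digit_prob i v * B"
        using digit_prob_nonneg[of v i] v by (simp add: k_def abs_mult)
    qed
    also have "\<dots> \<le> 1 * B"
      unfolding sum_distrib_right[symmetric] using v B0
      by (intro mult_right_mono) (auto simp: sum_digit_prob digit_tail_def)
    finally show ?thesis by simp
  qed
  have kbd: "\<bar>k i v\<bar> \<le> 2 * B" if "v \<in> {0..1}" for i v
    using sumbd[OF that, of i] sumbd[OF that, of "Suc i"] by simp
  have ksum: "(\<lambda>i. LBINT v:{0..1}. k i v) sums (LBINT v:{0..1}. h v / (1 + v))"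
  proof -
    have "\<bar>h x / (1 + x)\<bar> \<le> B" if "x \<in> {0..1}" for x
      using bd[OF that] that B0 mult_mono[of B B 1 "1 + x"] by (simp add: divide_le_eq)
    from gauss_branches_sums[of "\<lambda>v. h v / (1 + v)", OF _ this]
    have "(\<lambda>i. LBINT v:{0..1}. h (1 / (real i + 1 + v)) / (1 + 1 / (real i + 1 + v)) / (real i + 1 + v)\<^sup>2)
      sums (LBINT v:{0..1}. h v / (1 + v))" by simp
    moreover have "(LBINT v:{0..1}. h (1 / (real i + 1 + v)) / (1 + 1 / (real i + 1 + v)) / (real i + 1 + v)\<^sup>2)
        = (LBINT v:{0..1}. k i v)" for i
    proof (intro set_lebesgue_integral_cong allI impI)
      fix v :: real assume v: "v \<in> {0..1}"
      define c where "c = real i + 1 + v"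
      have c: "1 \<le> c" using v by (simp add: c_def)
      have "h (1 / c) / (1 + 1 / c) / c\<^sup>2 = h (1 / c) / ((c + 1) * c)"
        using c by (simp add: divide_simps power2_eq_square)
      moreover have "k i v = (1 + v) / (c * (c + 1)) * h (1 / c) / (1 + v)"
        by (simp add: k_def digit_prob_def c_def add_ac)
      moreover have "\<dots> = h (1 / c) / ((c + 1) * c)" using v by (simp add: mult_ac)
      ultimately show "h (1 / (real i + 1 + v)) / (1 + 1 / (real i + 1 + v)) / (real i + 1 + v)\<^sup>2 = k i v"
        by (simp only: c_def)
    qed simp
    ultimately show ?thesis by simp
  qed
  have "(\<lambda>n. LBINT v:{0..1}. \<Sum>i<n. k i v) \<longlonglongrightarrow> (LBINT v:{0..1}. Lh v / (1 + v))"
    unfolding set_lebesgue_integral_def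
  proof (rule integral_dominated_convergence)
    show "integrable lborel (\<lambda>v::real. indicator {0..1} v *\<^sub>R B)"
      unfolding set_integrable_def[symmetric]
      by (intro set_integrable_bounded_interval[where B = B]) (use B0 in auto)
    show "AE v in lborel. (\<lambda>n. indicat_real {0..1} v *\<^sub>R (\<Sum>i<n. k i v)) \<longlonglongrightarrow> indicat_real {0..1} v *\<^sub>R (Lh v / (1 + v))"
    proof (intro always_eventually allI)
      fix v :: real
      show "(\<lambda>n. indicat_real {0..1} v *\<^sub>R (\<Sum>i<n. k i v)) \<longlonglongrightarrow> indicat_real {0..1} v *\<^sub>R (Lh v / (1 + v))"
      proof (cases "v \<in> {0..1}")
        case True
        from sums_divide[OF s[OF True], of "1 + v"] show ?thesis
          using True by (simp add: sums_def k_def)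
      qed simp
    qed
    show "AE v in lborel. norm (indicat_real {0..1} v *\<^sub>R (\<Sum>i<n. k i v)) \<le> indicator {0..1} v *\<^sub>R B" for n
      using sumbd by (auto simp: indicator_def)
  qed auto
  moreover have "(LBINT v:{0..1}. \<Sum>i<n. k i v) = (\<Sum>i<n. LBINT v:{0..1}. k i v)" for n
  proof -
    have "set_integrable lborel {0..1} (k i)" for i
      by (intro set_integrable_bounded_interval[where B = "2 * B"] kbd) auto
    then show ?thesis
      unfolding set_lebesgue_integral_def set_integrable_def scaleR_sum_right
      by (intro Bochner_Integration.integral_sum)
  qed
  ultimately have "(\<lambda>n. \<Sum>i<n. LBINT v:{0..1}. k i v) \<longlonglongrightarrow> (LBINT v:{0..1}. Lh v / (1 + v))"
    by (simp only:)
  from LIMSEQ_unique[OF this ksum[unfolded sums_def]] show ?thesis .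
qed

section \<open>Decay of correlations\<close>

lemma gauss_height_diff:
  assumes "0 \<le> s" "0 \<le> t" "0 \<le> v"
  shows "\<bar>gauss_height (s, v) - gauss_height (t, v)\<bar> \<le> \<bar>s - t\<bar>"
proof -
  have p: "1 \<le> 1 + s * v" "1 \<le> 1 + t * v" using assms by auto
  have "s / (1 + s * v) - t / (1 + t * v) = (s - t) / ((1 + s * v) * (1 + t * v))"
    using p by (simp add: diff_frac_eq algebra_simps)
  then have "\<bar>gauss_height (s, v) - gauss_height (t, v)\<bar> = \<bar>s - t\<bar> / ((1 + s * v) * (1 + t * v))"
    using p by (simp add: gauss_height_def abs_mult)
  also have "\<dots> \<le> \<bar>s - t\<bar> / 1"
    using mult_mono[OF p] p by (intro divide_left_mono) auto
  finally show ?thesis by simp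
qed

text \<open>The derivative 1/(1+tv)^2 of the height in t, times 1+v, is exactly
  \<open>cond_density v t\<close>, so the substitution absorbs the whole density.\<close>

lemma gauss_height_substitution:
  fixes f :: "real \<Rightarrow> real"
  assumes [measurable]: "f \<in> borel_measurable borel" and bd: "\<And>x. \<bar>f x\<bar> \<le> B" and v: "0 \<le> v"
  shows "cond_expect v (\<lambda>t. f (gauss_height (t, v))) = (1 + v) * (LBINT z:{0..1 / (1 + v)}. f z)"
proof -
  have p: "1 \<le> 1 + t * v" if "0 \<le> t" for t using that v by simp
  have "(LBINT z:{0 / (1 + 0 * v)..1 / (1 + 1 * v)}. f z) = (LBINT t:{0..1}. f (t / (1 + t * v)) * (1 / (1 + t * v)\<^sup>2))"
  proof (rule set_integral_substitution)
    show "set_integrable lborel {0 / (1 + 0 * v)..1 / (1 + 1 * v)} f"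
      by (intro set_integrable_bounded_interval[where B = B] bd) auto
    show "((\<lambda>t. t / (1 + t * v)) has_real_derivative 1 / (1 + t * v)\<^sup>2) (at t)" if "t \<in> {0..1}" for t
      using p[of t] that by (auto intro!: derivative_eq_intros simp: power2_eq_square)
    show "continuous_on {0..1} (\<lambda>t. 1 / (1 + t * v)\<^sup>2)"
      using p by (intro continuous_intros) force
  qed auto
  then have "(LBINT z:{0..1 / (1 + v)}. f z) = (LBINT t:{0..1}. f (t / (1 + t * v)) * (1 / (1 + t * v)\<^sup>2))"
    by simp
  then have "(1 + v) * (LBINT z:{0..1 / (1 + v)}. f z)
      = (LBINT t:{0..1}. (1 + v) * (f (t / (1 + t * v)) * (1 / (1 + t * v)\<^sup>2)))"
    by (simp only: set_integral_mult_right)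
  also have "\<dots> = cond_expect v (\<lambda>t. f (gauss_height (t, v)))"
    unfolding cond_expect_def gauss_height_def cond_density_def by (simp add: mult_ac)
  finally show ?thesis by simp
qed

text \<open>Makes the domain independent of v, so that regularity in v can be read off the
  integrand.\<close>

lemma set_integral_rescale:
  fixes f :: "real \<Rightarrow> real"
  assumes [measurable]: "f \<in> borel_measurable borel" and bd: "\<And>x. \<bar>f x\<bar> \<le> B" and v: "0 \<le> v"
  shows "(1 + v) * (LBINT z:{0..1 / (1 + v)}. f z) = (LBINT u:{0..1}. f (u / (1 + v)))"
proof -
  have "(LBINT z:{0 / (1 + v)..1 / (1 + v)}. f z) = (LBINT u:{0..1}. f (u / (1 + v)) * (1 / (1 + v)))"
  proof (rule set_integral_substitution)
    show "set_integrable lborel {0 / (1 + v)..1 / (1 + v)} f"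
      by (intro set_integrable_bounded_interval[where B = B] bd) auto
    show "((\<lambda>t. t / (1 + v)) has_real_derivative 1 / (1 + v)) (at t)" for t
      using v by (auto intro!: derivative_eq_intros)
  qed (use v in auto)
  then show ?thesis using v by simp
qed

text \<open>Exchange the integrals: for fixed z the set of v in [0, 1] with z(1+v) <= 1 has length 1
  if z <= 1/2 and 1/z - 1 otherwise, which is \<open>ln 2 * nu_density z\<close>. The Gauss weight
  1/(1+v) is absent because it cancels against the factor 1+v of the conditional mean.\<close>

lemma nu_eq_gauss_mean:
  fixes f :: "real \<Rightarrow> real"
  assumes [measurable]: "f \<in> borel_measurable borel" and bd: "\<And>x. \<bar>f x\<bar> \<le> B"
  shows "(LBINT v:{0..1}. (LBINT z:{0..1 / (1 + v)}. f z)) = ln 2 * (LINT z|nu. f z)"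
proof -
  define H :: "real \<Rightarrow> real \<Rightarrow> real" where
    "H v z = indicator {0..1} v * (indicator {0..1} z * (if z * (1 + v) \<le> 1 then f z else 0))" for v z
  have [measurable]: "case_prod H \<in> borel_measurable (lborel \<Otimes>\<^sub>M lborel)"
    unfolding H_def by measurable
  have "0 \<le> B" using bd[of 0] by simp
  then have Hbd: "\<bar>H v z\<bar> \<le> B" for v z using bd by (auto simp: H_def indicator_def)
  have "integrable (lborel \<Otimes>\<^sub>M lborel) (\<lambda>p. indicator ({0..1} \<times> {0..1}) p *\<^sub>R case_prod H p)"
    using lborel.emeasure_pair_measure_Times[of "{0..1::real}" lborel "{0..1::real}"]
    by (intro integrableI_bounded_set_indicator[where B = B])
      (auto simp: Hbd emeasure_lborel_Icc_eq)
  moreover have "(\<lambda>p. indicator ({0..1} \<times> {0..1}) p *\<^sub>R case_prod H p) = case_prod H"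
    by (auto simp: H_def indicator_def)
  ultimately have int: "integrable (lborel \<Otimes>\<^sub>M lborel) (case_prod H)" by simp
  have inner_z: "(LBINT z. H v z) = indicator {0..1} v *\<^sub>R (LBINT z:{0..1 / (1 + v)}. f z)" for v
  proof (cases "v \<in> {0..1}")
    case True
    have "H v z = indicator {0..1 / (1 + v)} z *\<^sub>R f z" for z
    proof -
      have "z \<in> {0..1} \<and> z * (1 + v) \<le> 1 \<longleftrightarrow> z \<in> {0..1 / (1 + v)}"
      proof -
        have "1 / (1 + v) \<le> 1" using True by simp
        moreover have "z * (1 + v) \<le> 1 \<longleftrightarrow> z \<le> 1 / (1 + v)" using True by (simp add: le_divide_eq)
        ultimately show ?thesis by auto
      qed
      then show ?thesis using True by (auto simp: H_def indicator_def)
    qed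
    then show ?thesis using True by (simp add: set_lebesgue_integral_def)
  qed (simp add: H_def)
  have inner_v: "(LBINT v. H v z) = ln 2 * (nu_density z * f z)" for z
  proof (cases "0 \<le> z \<and> z \<le> 1")
    case True
    define b where "b = (if z \<le> 1 / 2 then 1 else 1 / z - 1)"
    have "indicat_real {0..1} v * (if z * (1 + v) \<le> 1 then 1 else 0) = indicat_real {0..b} v" for v :: real
    proof (cases "z \<le> 1 / 2")
      case z: True
      have "z * (1 + v) \<le> 1" if "v \<in> {0..1}" using mult_mono[of z "1/2" "1 + v" 2] z True that by simp
      then show ?thesis using z by (auto simp: b_def indicator_def)
    next
      case False
      then have "z * (1 + v) \<le> 1 \<longleftrightarrow> v \<le> 1 / z - 1" by (simp add: le_diff_eq le_divide_eq mult.commute add.commute)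
      moreover have "1 / z - 1 \<le> 1" using False by (simp add: divide_le_eq)
      ultimately show ?thesis using False by (auto simp: b_def indicator_def)
    qed
    moreover have "H v z = (indicat_real {0..1} v * (if z * (1 + v) \<le> 1 then 1 else 0)) * f z" for v
      using True by (auto simp: H_def indicator_def)
    ultimately have "H v z = indicat_real {0..b} v * f z" for v by (simp only:)
    then have "(LBINT v. H v z) = (LBINT v. indicat_real {0..b} v * f z)" by simp
    also have "\<dots> = b * f z"
      using True by (simp add: b_def divide_le_eq)
    also have "b = ln 2 * nu_density z" using True by (simp add: b_def nu_density_def)
    finally show ?thesis by simp
  qed (auto simp: H_def nu_density_def)
  have "(LBINT v:{0..1}. (LBINT z:{0..1 / (1 + v)}. f z)) = (LBINT v. LBINT z. H v z)"
    unfolding inner_z set_lebesgue_integral_def ..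
  also have "\<dots> = (LBINT z. LBINT v. H v z)"
    using lborel_pair.Fubini_integral[OF int] by simp
  also have "\<dots> = ln 2 * (LBINT z. nu_density z * f z)" unfolding inner_v by simp
  also have "(LBINT z. nu_density z * f z) = (LINT z|nu. f z)"
    unfolding nu_def by (subst integral_density) (auto simp: nu_density_nonneg)
  finally show ?thesis .
qed

section \<open>Observables along the natural extension\<close>

lemma gauss_ext_measurable [measurable]: "gauss_ext \<in> borel \<rightarrow>\<^sub>M borel"
  unfolding gauss_ext_def frac_def borel_prod[symmetric] by measurable

lemma gauss_height_measurable [measurable]: "gauss_height \<in> borel_measurable borel"
  unfolding gauss_height_def borel_prod[symmetric] by measurable

lemma gauss_ext_pow_measurable [measurable]: "gauss_ext ^^ m \<in> borel \<rightarrow>\<^sub>M borel"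
  by (induction m) (auto simp: id_def intro: measurable_comp)

definition height_obs :: "(real \<Rightarrow> real) \<Rightarrow> nat \<Rightarrow> real \<Rightarrow> real \<Rightarrow> real" where
  "height_obs f m t v = f (gauss_height ((gauss_ext ^^ m) (t, v)))"

lemma height_obs_measurable_pair:
  assumes [measurable]: "f \<in> borel_measurable borel"
  shows "(\<lambda>(t, v). height_obs f m t v) \<in> borel_measurable (borel \<Otimes>\<^sub>M borel)"
  unfolding height_obs_def borel_prod case_prod_unfold prod.collapse by measurable

lemma height_obs_measurable [measurable]:
  assumes "f \<in> borel_measurable borel"
  shows "(\<lambda>t. height_obs f m t v) \<in> borel_measurable borel"
  using measurable_compose[OF measurable_Pair2'[of v borel borel] height_obs_measurable_pair[OF assms, of m]] by simp

text \<open>At s = 1 the floor jumps to i+2 and the identity fails. This is why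
  \<open>cond_expect_cong\<close> asks for agreement on the open interval only.\<close>

lemma gauss_ext_branch:
  assumes "0 \<le> s" "s < 1"
  shows "gauss_ext (1 / (real i + 1 + s), v) = (s, 1 / (real i + 1 + v))"
proof -
  have "\<lfloor>real i + 1 + s\<rfloor> = int i + 1" using assms by (intro floor_unique) auto
  then show ?thesis by (simp add: gauss_ext_def frac_def)
qed

lemma height_obs_branch:
  assumes "0 \<le> s" "s < 1"
  shows "height_obs f (Suc m) (1 / (real i + 1 + s)) v = height_obs f m s (1 / (real i + 1 + v))"
  by (simp add: height_obs_def funpow_Suc_right gauss_ext_branch[OF assms] del: funpow.simps)

text \<open>Bounds on the whole line spare the later estimates any check that the arguments of f lie
  in [0, 1].\<close>

locale height_observable =
  fixes f :: "real \<Rightarrow> real" and B K :: real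
  assumes meas [measurable]: "f \<in> borel_measurable borel"
    and bounded: "\<bar>f x\<bar> \<le> B"
    and lipschitz: "\<bar>f x - f y\<bar> \<le> K * \<bar>x - y\<bar>"
    and centered: "(LINT z|nu. f z) = 0"
begin

lemma B_nonneg: "0 \<le> B"
  using bounded[of 0] by simp

lemma K_nonneg: "0 \<le> K"
  using lipschitz[of 0 1] by simp

lemma obs_measurable [measurable]: "(\<lambda>t. height_obs f m t v) \<in> borel_measurable borel"
  by (rule height_obs_measurable[OF meas])

lemma obs_bounded: "\<bar>height_obs f m t v\<bar> \<le> B"
  unfolding height_obs_def by (rule bounded)

definition cond_mean :: "nat \<Rightarrow> real \<Rightarrow> real" where
  "cond_mean m v = cond_expect v (\<lambda>t. height_obs f m t v)"

lemma cond_mean_measurable [measurable]: "cond_mean m \<in> borel_measurable borel"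
proof -
  have [measurable]: "(\<lambda>(v, t). height_obs f m t v) \<in> borel_measurable (borel \<Otimes>\<^sub>M borel)"
    using measurable_compose[OF measurable_pair_swap' height_obs_measurable_pair[OF meas, of m]]
    by (simp add: case_prod_unfold)
  have "(\<lambda>(v, t). indicator {0..1} t *\<^sub>R (height_obs f m t v * ((1 + v) / (1 + v * t)\<^sup>2))) \<in> borel_measurable (borel \<Otimes>\<^sub>M lborel)"
    by measurable
  from lborel.borel_measurable_lebesgue_integral[OF this] show ?thesis
    unfolding cond_mean_def[abs_def] cond_expect_def set_lebesgue_integral_def cond_density_def by simp
qed

lemma cond_mean_bounded:
  assumes "v \<in> {0..1}"
  shows "\<bar>cond_mean m v\<bar> \<le> 2 * B"
  unfolding cond_mean_def using assms by (intro abs_cond_expect_le obs_bounded) auto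

lemma cond_mean_step:
  assumes "v \<in> {0..1}"
  shows "(\<lambda>i. digit_prob i v * cond_mean m (1 / (real i + 1 + v))) sums cond_mean (Suc m) v"
proof -
  have "cond_expect (1 / (real i + 1 + v)) (\<lambda>s. height_obs f (Suc m) (1 / (real i + 1 + s)) v)
      = cond_mean m (1 / (real i + 1 + v))" for i
    unfolding cond_mean_def by (intro cond_expect_cong height_obs_branch) auto
  then show ?thesis
    using cond_expect_step[of "\<lambda>t. height_obs f (Suc m) t v" B v] assms obs_bounded
    by (simp add: cond_mean_def[of "Suc m"])
qed

lemma cond_mean_0: "0 \<le> v \<Longrightarrow> cond_mean 0 v = (1 + v) * (LBINT z:{0..1 / (1 + v)}. f z)"
  using gauss_height_substitution[OF meas bounded] by (simp add: cond_mean_def height_obs_def)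

lemma cond_mean_lipschitz:
  assumes "x \<in> {0..1}" "y \<in> {0..1}"
  shows "\<bar>cond_mean m x - cond_mean m y\<bar> \<le> K * (11 / 12) ^ m * \<bar>x - y\<bar>"
  using assms
proof (induction m arbitrary: x y)
  case 0
  \<comment> \<open>In this form v enters only through u/(1+v), which is 1-Lipschitz in v for u in
    [0, 1].\<close>
  have eq: "cond_mean 0 v = (LBINT u:{0..1}. f (u / (1 + v)))" if "v \<in> {0..1}" for v
    using that by (simp add: cond_mean_0 set_integral_rescale[OF meas bounded])
  have int: "set_integrable lborel {0..1} (\<lambda>u. f (u / (1 + v)))" for v
    by (intro set_integrable_bounded_interval[where B = B] bounded) simp
  have "cond_mean 0 x - cond_mean 0 y = (LBINT u:{0..1}. f (u / (1 + x)) - f (u / (1 + y)))"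
    using 0 int by (simp add: eq set_integral_diff)
  also have "\<bar>\<dots>\<bar> \<le> (K * \<bar>x - y\<bar>) * (1 - 0)"
  proof (rule abs_set_integral_le_interval)
    fix u :: real assume u: "u \<in> {0..1}"
    have p: "1 \<le> 1 + x" "1 \<le> 1 + y" using 0 by auto
    have "u / (1 + x) - u / (1 + y) = u * (y - x) / ((1 + x) * (1 + y))"
      using p by (simp add: diff_frac_eq algebra_simps)
    then have "\<bar>u / (1 + x) - u / (1 + y)\<bar> = u * \<bar>x - y\<bar> / ((1 + x) * (1 + y))"
      using u p by (simp add: abs_mult abs_minus_commute)
    also have "\<dots> \<le> 1 * \<bar>x - y\<bar> / 1"
      using u p mult_mono[OF p] by (intro frac_le mult_mono) auto
    finally have "K * \<bar>u / (1 + x) - u / (1 + y)\<bar> \<le> K * \<bar>x - y\<bar>"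
      using K_nonneg by (intro mult_left_mono) auto
    then show "\<bar>f (u / (1 + x)) - f (u / (1 + y))\<bar> \<le> K * \<bar>x - y\<bar>"
      using lipschitz order_trans by blast
  qed auto
  finally show ?case by simp
next
  case (Suc m)
  have "\<bar>cond_mean (Suc m) x - cond_mean (Suc m) y\<bar> \<le> 11 / 12 * (K * (11 / 12) ^ m) * \<bar>x - y\<bar>"
    by (rule average_contraction[OF Suc.IH Suc.prems cond_mean_step[OF Suc.prems(1)] cond_mean_step[OF Suc.prems(2)]])
  then show ?case by (simp add: mult_ac)
qed

lemma cond_mean_gauss_mean: "(LBINT v:{0..1}. cond_mean m v / (1 + v)) = 0"
proof (induction m)
  case 0
  have "(LBINT v:{0..1}. cond_mean 0 v / (1 + v)) = (LBINT v:{0..1}. (LBINT z:{0..1 / (1 + v)}. f z))"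
    by (intro set_lebesgue_integral_cong) (auto simp: cond_mean_0)
  then show ?case by (simp add: nu_eq_gauss_mean[OF meas bounded] centered)
next
  case (Suc m)
  have "(LBINT v:{0..1}. cond_mean (Suc m) v / (1 + v)) = (LBINT v:{0..1}. cond_mean m v / (1 + v))"
    by (rule gauss_mean_invariant[where B = "2 * B"]) (auto intro: cond_mean_bounded cond_mean_step)
  then show ?case using Suc by simp
qed

text \<open>On [0, 1] a function with Lipschitz constant L varies by at most L. If its modulus
  exceeded L somewhere, it would keep one sign and stay away from 0, contradicting its vanishing
  Gauss mean.\<close>

lemma cond_mean_decay:
  assumes v: "v \<in> {0..1}"
  shows "\<bar>cond_mean m v\<bar> \<le> K * (11 / 12) ^ m"
proof (rule ccontr)
  define L where "L = K * (11 / 12) ^ m"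
  define J where "J = (LBINT w:{0..1}. 1 / (1 + w::real))"
  have L0: "0 \<le> L" using K_nonneg by (simp add: L_def)
  have int: "set_integrable lborel {0..1} (\<lambda>w. g w / (1 + w))"
    if [measurable]: "g \<in> borel_measurable borel" and "\<And>w. w \<in> {0..1} \<Longrightarrow> \<bar>g w\<bar> \<le> D" for g :: "real \<Rightarrow> real" and D
  proof (intro set_integrable_bounded_interval[where B = D])
    fix w :: real assume w: "w \<in> {0..1}"
    have "\<bar>g w\<bar> / (1 + w) \<le> \<bar>g w\<bar> / 1" using w by (intro divide_left_mono) auto
    then show "\<bar>g w / (1 + w)\<bar> \<le> D" using w that(2)[OF w] by simp
  qed simp
  have "(LBINT w:{0..1::real}. 1 / 2) \<le> J" unfolding J_def
    by (intro set_integral_mono int set_integrable_bounded_interval[where B = 1]) (auto intro!: divide_left_mono)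
  then have J: "0 < J" by (simp add: set_lebesgue_integral_def)
  have imono: "(LBINT w:{0..1}. c * (1 / (1 + w))) \<le> (LBINT w:{0..1}. s * cond_mean m w / (1 + w))"
    if "\<And>w. w \<in> {0..1} \<Longrightarrow> c \<le> s * cond_mean m w" and s: "\<bar>s\<bar> = 1" for c s :: real
  proof (rule set_integral_mono)
    show "set_integrable lborel {0..1} (\<lambda>w. c * (1 / (1 + w)))"
      using int[of "\<lambda>_. c" "\<bar>c\<bar>"] by simp
    show "set_integrable lborel {0..1} (\<lambda>w. s * cond_mean m w / (1 + w))"
      using cond_mean_bounded s by (intro int[where D = "2 * B"]) (auto simp: abs_mult)
    show "c * (1 / (1 + w)) \<le> s * cond_mean m w / (1 + w)" if "w \<in> {0..1}" for w
      using that \<open>\<And>w. w \<in> {0..1} \<Longrightarrow> c \<le> s * cond_mean m w\<close> by (simp add: divide_right_mono)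
  qed
  assume "\<not> \<bar>cond_mean m v\<bar> \<le> K * (11 / 12) ^ m"
  \<comment> \<open>The sign s treats both signs of the conditional mean at once.\<close>
  then obtain s :: real where s: "\<bar>s\<bar> = 1" "L < s * cond_mean m v"
    by (cases "0 \<le> cond_mean m v") (auto simp: L_def intro: that[of 1] that[of "-1"])
  have "s * cond_mean m v - L \<le> s * cond_mean m w" if w: "w \<in> {0..1}" for w
  proof -
    have "s * cond_mean m v - s * cond_mean m w \<le> \<bar>s * (cond_mean m v - cond_mean m w)\<bar>"
      by (simp add: right_diff_distrib)
    also have "\<dots> = \<bar>cond_mean m v - cond_mean m w\<bar>" by (simp add: abs_mult s)
    also have "\<dots> \<le> L * \<bar>v - w\<bar>" using cond_mean_lipschitz[OF v w] by (simp add: L_def)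
    also have "\<dots> \<le> L * 1" using v w L0 by (intro mult_left_mono) auto
    finally show ?thesis by simp
  qed
  from imono[OF this s(1)]
  have "(s * cond_mean m v - L) * J \<le> (LBINT w:{0..1}. s * cond_mean m w / (1 + w))"
    by (simp only: set_integral_mult_right J_def)
  also have "\<dots> = (LBINT w:{0..1}. s * (cond_mean m w / (1 + w)))" by simp
  also have "\<dots> = s * (LBINT w:{0..1}. cond_mean m w / (1 + w))" by (simp only: set_integral_mult_right)
  also have "\<dots> = 0" by (simp add: cond_mean_gauss_mean)
  finally have "(s * cond_mean m v - L) * J \<le> 0" .
  moreover have "0 < (s * cond_mean m v - L) * J" using s(2) J by simp
  ultimately show False by linarith
qed

text \<open>Condition on the first \<open>2 * r\<close> partial quotients: \<open>u\<close> is then constant up to an error \<open>L / 4 ^ r\<close>,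
  because two inverse branches of the Gauss map together contract by \<open>1/4\<close>, whereas a single branch
  need not contract.\<close>

lemma decorrelation:
  assumes [measurable]: "u \<in> borel_measurable borel"
    and "\<And>t. t \<in> {0..1} \<Longrightarrow> \<bar>u t\<bar> \<le> A"
    and "\<And>s t. s \<in> {0..1} \<Longrightarrow> t \<in> {0..1} \<Longrightarrow> \<bar>u s - u t\<bar> \<le> L * \<bar>s - t\<bar>"
    and "v \<in> {0..1}" and "2 * r \<le> m"
  shows "\<bar>cond_expect v (\<lambda>t. u t * height_obs f m t v)\<bar> \<le> A * (K * (11 / 12) ^ (m - 2 * r)) + 2 * (L / 4 ^ r * B)"
  using assms
proof (induction r arbitrary: u v m L)
  case 0
  note [measurable] = 0(1)
  have L0: "0 \<le> L" using 0(3)[of 0 1] by simp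
  have d: "\<bar>u t - u 0\<bar> \<le> L" if "t \<in> {0..1}" for t
  proof -
    have "\<bar>u t - u 0\<bar> \<le> L * \<bar>t - 0\<bar>" using that by (intro 0(3)) auto
    also have "\<dots> \<le> L * 1" using that L0 by (intro mult_left_mono) auto
    finally show ?thesis by simp
  qed
  have i1: "set_integrable lborel {0..1} (\<lambda>t. u 0 * (height_obs f m t v * cond_density v t))"
    using 0(4) obs_bounded by (intro set_integrable_mult_right cond_expect_integrable[where B = B]) auto
  have b2: "\<bar>(u t - u 0) * height_obs f m t v\<bar> \<le> L * B" if "t \<in> {0..1}" for t
    unfolding abs_mult using d[OF that] obs_bounded L0 by (intro mult_mono) auto
  have i2: "set_integrable lborel {0..1} (\<lambda>t. (u t - u 0) * height_obs f m t v * cond_density v t)"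
    using 0(4) b2 by (intro cond_expect_integrable[where B = "L * B"]) auto
  \<comment> \<open>Freezing u at 0 leaves a multiple of the conditional mean, which decays, and an
    error with |u t - u 0| <= L. The factor 2 in the error is the upper bound of
    \<open>cond_density\<close>.\<close>
  have "cond_expect v (\<lambda>t. u t * height_obs f m t v)
      = (LBINT t:{0..1}. u 0 * (height_obs f m t v * cond_density v t) + (u t - u 0) * height_obs f m t v * cond_density v t)"
    unfolding cond_expect_def by (simp add: algebra_simps)
  also have "\<dots> = u 0 * cond_mean m v + cond_expect v (\<lambda>t. (u t - u 0) * height_obs f m t v)"
    unfolding set_integral_add(2)[OF i1 i2] cond_expect_def cond_mean_def by simp
  finally have eq: "cond_expect v (\<lambda>t. u t * height_obs f m t v)
      = u 0 * cond_mean m v + cond_expect v (\<lambda>t. (u t - u 0) * height_obs f m t v)" .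
  have "\<bar>u 0 * cond_mean m v\<bar> \<le> A * (K * (11 / 12) ^ m)"
    unfolding abs_mult using 0(2)[of 0] cond_mean_decay[OF 0(4)] by (intro mult_mono) auto
  moreover have "\<bar>cond_expect v (\<lambda>t. (u t - u 0) * height_obs f m t v)\<bar> \<le> 2 * (L * B)"
    using 0(4) b2 by (intro abs_cond_expect_le) auto
  ultimately show ?case unfolding eq by simp
next
  case (Suc r)
  note [measurable] = Suc.prems(1)
  obtain m' where m: "m = Suc (Suc m')" using Suc.prems(5) by (cases m; cases "m - 1") auto
  have A0: "0 \<le> A" using Suc.prems(2)[of 0] by simp
  define D where "D = A * (K * (11 / 12) ^ (m' - 2 * r)) + 2 * (L / 4 / 4 ^ r * B)"
  have bd: "\<bar>u t * height_obs f n t' v'\<bar> \<le> A * B" if "t \<in> {0..1}" for t n t' v'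
    unfolding abs_mult using Suc.prems(2)[OF that] obs_bounded A0 by (intro mult_mono) auto
  \<comment> \<open>The outer average uses up one digit, hence the index \<open>Suc m'\<close>. The
    average over the second digit lowers it to m', where the induction hypothesis applies with L/4
    in place of L.\<close>
  have inner: "\<bar>cond_expect w (\<lambda>s. u (1 / (real i + 1 + s)) * height_obs f (Suc m') s w)\<bar> \<le> D"
    if w: "w \<in> {0..1}" for i w
  proof (rule abs_average_le)
    show "0 \<le> w" using w by simp
    show "(\<lambda>j. digit_prob j w * cond_expect (1 / (real j + 1 + w))
        (\<lambda>s. u (1 / (real i + 1 + 1 / (real j + 1 + s))) * height_obs f (Suc m') (1 / (real j + 1 + s)) w))
      sums cond_expect w (\<lambda>s. u (1 / (real i + 1 + s)) * height_obs f (Suc m') s w)"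
      using w by (intro cond_expect_step[where B = "A * B"] bd) (auto)
    fix j
    let ?u = "\<lambda>s. u (1 / (real i + 1 + 1 / (real j + 1 + s)))" and ?w = "1 / (real j + 1 + w)"
    have "cond_expect ?w (\<lambda>s. ?u s * height_obs f (Suc m') (1 / (real j + 1 + s)) w)
        = cond_expect ?w (\<lambda>s. ?u s * height_obs f m' s ?w)"
      by (intro cond_expect_cong) (auto simp: height_obs_branch)
    moreover have "\<bar>cond_expect ?w (\<lambda>s. ?u s * height_obs f m' s ?w)\<bar> \<le> D"
      unfolding D_def
    proof (rule Suc.IH)
      have unit: "1 / (real i + 1 + 1 / (real j + 1 + t)) \<in> {0..1}" if "t \<in> {0..1}" for t
        using digit_branch_bounds[of "1 / (real j + 1 + t)" i] that by simp
      show "?w \<in> {0..1}" using w by simp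
      show "2 * r \<le> m'" using Suc.prems(5) m by simp
      show "\<bar>?u t\<bar> \<le> A" if "t \<in> {0..1}" for t by (intro Suc.prems(2) unit that)
      fix s t :: real assume st: "s \<in> {0..1}" "t \<in> {0..1}"
      define a b where "a = real i + 1" and "b = real j + 1"
      have ab: "1 \<le> a" "1 \<le> b" by (simp_all add: a_def b_def)
      \<comment> \<open>Two branches compose to a Moebius map of determinant 1 with denominator at
        least 2 on [0, 1], so differences shrink by the factor 2 * 2.\<close>
      have g: "1 / (a + 1 / (b + x)) = (b + x) / (a * (b + x) + 1)" if "0 \<le> x" for x
        using that ab by (simp add: divide_simps add_pos_nonneg)
      have ge2: "2 \<le> a * (b + x) + 1" if "0 \<le> x" for x
        using mult_mono[of 1 a 1 "b + x"] that ab by simp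
      have "1 / (a + 1 / (b + s)) - 1 / (a + 1 / (b + t)) = (s - t) / ((a * (b + s) + 1) * (a * (b + t) + 1))"
        using g[of s] g[of t] ge2[of s] ge2[of t] st by (simp add: diff_frac_eq) (simp add: algebra_simps)
      then have "\<bar>1 / (a + 1 / (b + s)) - 1 / (a + 1 / (b + t))\<bar> = \<bar>s - t\<bar> / ((a * (b + s) + 1) * (a * (b + t) + 1))"
        using ge2[of s] ge2[of t] st by (simp add: abs_mult)
      also have "\<dots> \<le> \<bar>s - t\<bar> / (2 * 2)"
        using ge2[of s] ge2[of t] st by (intro divide_left_mono mult_mono) auto
      finally have *: "\<bar>1 / (a + 1 / (b + s)) - 1 / (a + 1 / (b + t))\<bar> \<le> \<bar>s - t\<bar> / 4" by simp
      have L0: "0 \<le> L" using Suc.prems(3)[of 0 1] by simp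
      have "\<bar>?u s - ?u t\<bar> \<le> L * \<bar>1 / (a + 1 / (b + s)) - 1 / (a + 1 / (b + t))\<bar>"
        unfolding a_def b_def by (intro Suc.prems(3) unit st)
      also have "\<dots> \<le> L * (\<bar>s - t\<bar> / 4)" using * L0 by (intro mult_left_mono)
      finally show "\<bar>?u s - ?u t\<bar> \<le> L / 4 * \<bar>s - t\<bar>" by simp
    qed simp
    ultimately show "\<bar>cond_expect ?w (\<lambda>s. ?u s * height_obs f (Suc m') (1 / (real j + 1 + s)) w)\<bar> \<le> D"
      by simp
  qed
  have "\<bar>cond_expect v (\<lambda>t. u t * height_obs f m t v)\<bar> \<le> D"
  proof (rule abs_average_le)
    show "0 \<le> v" using Suc.prems(4) by simp
    show "(\<lambda>i. digit_prob i v * cond_expect (1 / (real i + 1 + v))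
        (\<lambda>s. u (1 / (real i + 1 + s)) * height_obs f m (1 / (real i + 1 + s)) v))
      sums cond_expect v (\<lambda>t. u t * height_obs f m t v)"
      using Suc.prems(4) by (intro cond_expect_step[where B = "A * B"] bd) auto
    fix i
    let ?w = "1 / (real i + 1 + v)"
    have "cond_expect ?w (\<lambda>s. u (1 / (real i + 1 + s)) * height_obs f m (1 / (real i + 1 + s)) v)
        = cond_expect ?w (\<lambda>s. u (1 / (real i + 1 + s)) * height_obs f (Suc m') s ?w)"
      unfolding m by (intro cond_expect_cong) (auto simp: height_obs_branch)
    then show "\<bar>cond_expect ?w (\<lambda>s. u (1 / (real i + 1 + s)) * height_obs f m (1 / (real i + 1 + s)) v)\<bar> \<le> D"
      using inner[of ?w i] Suc.prems(4) by simp
  qed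
  also have "D = A * (K * (11 / 12) ^ (m - 2 * Suc r)) + 2 * (L / 4 ^ Suc r * B)"
    by (simp add: D_def m)
  finally show ?case .
qed

end

section \<open>Variance of block sums and the almost sure bound\<close>

lemma sum_geometric_inj_le:
  fixes q :: real
  assumes "0 \<le> q" "q < 1" "finite A" "inj_on g A"
  shows "(\<Sum>k\<in>A. q ^ g k) \<le> 1 / (1 - q)"
proof -
  have "(\<Sum>k\<in>A. q ^ g k) = (\<Sum>m\<in>g ` A. q ^ m)"
    using assms(4) by (simp add: sum.reindex)
  also have "\<dots> \<le> (\<Sum>m. q ^ m)"
    using assms by (intro sum_le_suminf summable_geometric) auto
  also have "\<dots> = 1 / (1 - q)" using assms by (intro suminf_geometric) auto
  finally show ?thesis .
qed

lemma sum_geometric_dist_le: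
  fixes q :: real
  assumes "0 \<le> q" "q < 1" "finite A"
  shows "(\<Sum>k\<in>A. q ^ (max j k - min j k)) \<le> 2 / (1 - q)"
proof -
  have "(\<Sum>k\<in>A. q ^ (max j k - min j k))
      = (\<Sum>k\<in>A \<inter> {k. k \<le> j}. q ^ (j - k)) + (\<Sum>k\<in>A \<inter> - {k. k \<le> j}. q ^ (k - j))"
    unfolding sum.Int_Diff[OF assms(3), of _ "{k. k \<le> j}"] Diff_eq
    by (intro arg_cong2[where f = "(+)"] sum.cong) (auto simp: max_def min_def)
  also have "\<dots> \<le> 1 / (1 - q) + 1 / (1 - q)"
    using assms by (intro add_mono sum_geometric_inj_le) (auto simp: inj_on_def)
  finally show ?thesis by simp
qed

text \<open>\<open>49/50\<close> slightly exceeds the fourth root of \<open>11/12\<close>.\<close>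

lemma power_div_4_le: "(11 / 12 :: real) ^ (m div 4) \<le> 2 * (49 / 50) ^ m"
proof -
  have "(11 / 12 :: real) ^ (m div 4) \<le> ((49 / 50) ^ 4) ^ (m div 4)"
    by (intro power_mono) (auto simp: power_numeral_reduce)
  also have "\<dots> = (49 / 50) ^ (4 * (m div 4))" by (simp add: power_mult)
  also have "\<dots> \<le> 2 * (49 / 50) ^ m"
  proof -
    have "(1 / 2 :: real) \<le> (49 / 50) ^ 3" by (simp add: power_numeral_reduce)
    also have "\<dots> \<le> (49 / 50) ^ (m mod 4)" by (intro power_decreasing) auto
    finally have "(49 / 50 :: real) ^ (4 * (m div 4)) * 1 \<le> (49 / 50) ^ (4 * (m div 4)) * (2 * (49 / 50) ^ (m mod 4))"
      by (intro mult_left_mono) auto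
    also have "\<dots> = 2 * (49 / 50) ^ (4 * (m div 4) + m mod 4)" by (simp only: power_add mult_ac)
    finally show ?thesis by simp
  qed
  finally show ?thesis .
qed

text \<open>Every \<theta> is an integer translate of its fractional part, translations preserve
  \<open>lborel\<close>, and countably many null sets have a null union.\<close>

lemma AE_lborel_frac:
  fixes P :: "real \<Rightarrow> bool"
  assumes "AE t in lborel. t \<in> {0..1} \<longrightarrow> P t"
  shows "AE \<theta> in lborel. P (frac \<theta>)"
proof -
  have "AE \<theta> in lborel. of_int n + \<theta> \<in> {0..1} \<longrightarrow> P (of_int n + \<theta>)" for n :: int
    by (rule AE_distrD[of "(+) (of_int n)" lborel borel "\<lambda>t. t \<in> {0..1} \<longrightarrow> P t",
          unfolded lborel_distr_plus, OF _ assms]) simp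
  then have "AE \<theta> in lborel. \<forall>n::int. of_int n + \<theta> \<in> {0..1} \<longrightarrow> P (of_int n + \<theta>)"
    by (simp add: AE_all_countable)
  then show ?thesis
  proof eventually_elim
    case (elim \<theta>)
    have "of_int (- \<lfloor>\<theta>\<rfloor>) + \<theta> = frac \<theta>" by (simp add: frac_def)
    moreover have "frac \<theta> \<in> {0..1}" using frac_ge_0[of \<theta>] frac_lt_1[of \<theta>] by simp
    ultimately show ?case using elim by metis
  qed
qed

lemma AE_irrational: "AE \<theta> in lborel. (\<theta> :: real) \<notin> \<rat>"
  by (intro AE_not_in countable_imp_null_set_lborel countable_rat)

text \<open>\<open>gauss_ext\<close> preserves nonnegativity of both coordinates, and t/(1+tv) <= t.
  Rational \<theta> are no exception: 1/0 = 0 keeps the first coordinate at 0 once it arrives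
  there.\<close>

lemma gauss_height_orbit_bounds:
  "gauss_height ((gauss_ext ^^ k) (frac \<theta>, 0)) \<in> {0..1}"
proof -
  have inv: "fst ((gauss_ext ^^ k) (frac \<theta>, 0)) \<in> {0..1} \<and> 0 \<le> snd ((gauss_ext ^^ k) (frac \<theta>, 0))"
  proof (induction k)
    case 0
    show ?case using frac_ge_0[of \<theta>] frac_lt_1[of \<theta>] by simp
  next
    case (Suc k)
    obtain t v where tv: "(gauss_ext ^^ k) (frac \<theta>, 0) = (t, v)" by fastforce
    have "0 \<le> real_of_int \<lfloor>1 / t\<rfloor>" using Suc tv by simp
    then show ?case using Suc tv frac_ge_0[of "1 / t"] frac_lt_1[of "1 / t"] by (simp add: gauss_ext_def)
  qed
  obtain t v where tv: "(gauss_ext ^^ k) (frac \<theta>, 0) = (t, v)" by fastforce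
  have "0 \<le> t" "t \<le> 1" "0 \<le> t * v" using inv tv by auto
  then show ?thesis by (simp add: tv gauss_height_def divide_le_eq)
qed

context height_observable
begin

text \<open>Averaging over the next digit lowers both indices by one at the price of a new v. The
  estimate is uniform in v, so it reduces to j = 0, where the first factor is K-Lipschitz in t and
  \<open>decorrelation\<close> applies.\<close>

lemma correlation_decay:
  assumes "j \<le> k" "v \<in> {0..1}"
  shows "\<bar>cond_expect v (\<lambda>t. height_obs f j t v * height_obs f k t v)\<bar> \<le> 3 * (K * B) * (11 / 12) ^ ((k - j) div 4)"
  using assms
proof (induction j arbitrary: k v)
  case 0
  \<comment> \<open>Of the k steps, 2r freeze the first factor and k - 2r >= r remain for the decay
    of the mean. Both errors are then of order (11/12)^r, with coefficients 1 and 2, which add up to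
    3.\<close>
  define r where "r = k div 4"
  have r: "2 * r \<le> k" "r \<le> k - 2 * r" by (simp_all add: r_def)
  have KB: "0 \<le> K * B" using K_nonneg B_nonneg by simp
  have "\<bar>cond_expect v (\<lambda>t. height_obs f 0 t v * height_obs f k t v)\<bar>
      \<le> B * (K * (11 / 12) ^ (k - 2 * r)) + 2 * (K / 4 ^ r * B)"
  proof (rule decorrelation)
    fix s t :: real assume st: "s \<in> {0..1}" "t \<in> {0..1}"
    have "\<bar>height_obs f 0 s v - height_obs f 0 t v\<bar> \<le> K * \<bar>gauss_height (s, v) - gauss_height (t, v)\<bar>"
      unfolding height_obs_def using lipschitz by simp
    also have "\<dots> \<le> K * \<bar>s - t\<bar>"
      using st 0 K_nonneg by (intro mult_left_mono gauss_height_diff) auto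
    finally show "\<bar>height_obs f 0 s v - height_obs f 0 t v\<bar> \<le> K * \<bar>s - t\<bar>" .
  qed (use r 0 obs_bounded in auto)
  also have "\<dots> = (K * B) * (11 / 12) ^ (k - 2 * r) + 2 * (K * B) * (1 / 4) ^ r"
    by (simp add: power_one_over)
  also have "\<dots> \<le> (K * B) * (11 / 12) ^ r + 2 * (K * B) * (11 / 12) ^ r"
    using KB r by (intro add_mono mult_left_mono power_decreasing power_mono) auto
  finally show ?case by (simp add: r_def mult_ac)
next
  case (Suc j)
  obtain k' where k: "k = Suc k'" "j \<le> k'" using Suc.prems(1) by (cases k) auto
  show ?case
  proof (rule abs_average_le)
    show "0 \<le> v" using Suc.prems by simp
    show "(\<lambda>i. digit_prob i v * cond_expect (1 / (real i + 1 + v))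
          (\<lambda>s. height_obs f (Suc j) (1 / (real i + 1 + s)) v * height_obs f k (1 / (real i + 1 + s)) v))
        sums cond_expect v (\<lambda>t. height_obs f (Suc j) t v * height_obs f k t v)"
      using Suc.prems obs_bounded B_nonneg
      by (intro cond_expect_step[where B = "B * B"]) (auto simp: abs_mult intro!: mult_mono)
    fix i
    let ?w = "1 / (real i + 1 + v)"
    have "cond_expect ?w (\<lambda>s. height_obs f (Suc j) (1 / (real i + 1 + s)) v * height_obs f k (1 / (real i + 1 + s)) v)
        = cond_expect ?w (\<lambda>s. height_obs f j s ?w * height_obs f k' s ?w)"
      unfolding k by (intro cond_expect_cong) (auto simp: height_obs_branch)
    then show "\<bar>cond_expect ?w (\<lambda>s. height_obs f (Suc j) (1 / (real i + 1 + s)) v * height_obs f k (1 / (real i + 1 + s)) v)\<bar>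
        \<le> 3 * (K * B) * (11 / 12) ^ ((k - Suc j) div 4)"
      using Suc.IH[of k' ?w] Suc.prems k by simp
  qed
qed

lemma correlation_bound:
  assumes "v \<in> {0..1}"
  shows "\<bar>cond_expect v (\<lambda>t. height_obs f j t v * height_obs f k t v)\<bar>
    \<le> 6 * (K * B) * (49 / 50) ^ (max j k - min j k)"
proof -
  have "\<bar>cond_expect v (\<lambda>t. height_obs f j t v * height_obs f k t v)\<bar>
      \<le> 3 * (K * B) * (11 / 12) ^ ((max j k - min j k) div 4)"
    using correlation_decay[of j k v] correlation_decay[of k j v] assms
    by (cases "j \<le> k") (simp_all add: max_def min_def mult.commute)
  also have "\<dots> \<le> 3 * (K * B) * (2 * (49 / 50) ^ (max j k - min j k))"
    using K_nonneg B_nonneg by (intro mult_left_mono power_div_4_le) auto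
  finally show ?thesis by simp
qed

text \<open>For v = 0 the density is 1 on [0, 1], so \<open>cond_expect 0\<close> is plain
  integration there. Each row of the correlation matrix sums to at most 6 K B * 2/(1 - 49/50) = 600
  K B. The indicator moves everything to the full line, as \<open>gal_koksma\<close> is applied to
  \<open>lborel\<close>.\<close>

lemma block_variance:
  fixes m n :: nat
  defines "S \<equiv> \<lambda>t. (\<Sum>k\<in>{m..<m + n}. indicat_real {0..1} t * height_obs f k t 0)\<^sup>2"
  shows "integrable lborel S" and "(LBINT t. S t) \<le> 600 * (K * B) * real n"
proof -
  let ?A = "{m..<m + n}"
  have S: "S t = (\<Sum>j\<in>?A. \<Sum>k\<in>?A. indicator {0..1} t *\<^sub>R (height_obs f j t 0 * height_obs f k t 0 * cond_density 0 t))" for t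
  proof -
    have "S t = (\<Sum>j\<in>?A. \<Sum>k\<in>?A. (indicat_real {0..1} t * height_obs f j t 0) * (indicat_real {0..1} t * height_obs f k t 0))"
      unfolding S_def power2_eq_square sum_product ..
    also have "\<dots> = (\<Sum>j\<in>?A. \<Sum>k\<in>?A. indicator {0..1} t *\<^sub>R (height_obs f j t 0 * height_obs f k t 0 * cond_density 0 t))"
      by (intro sum.cong refl) (auto simp: indicator_def cond_density_def)
    finally show ?thesis .
  qed
  have int: "integrable lborel (\<lambda>t. indicator {0..1} t *\<^sub>R (height_obs f j t 0 * height_obs f k t 0 * cond_density 0 t))" for j k
    unfolding set_integrable_def[symmetric] using obs_bounded B_nonneg
    by (intro cond_expect_integrable[where B = "B * B"]) (auto simp: abs_mult intro!: mult_mono)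
  show "integrable lborel S" unfolding S by (intro Bochner_Integration.integrable_sum int)
  have "(LBINT t. S t) = (\<Sum>j\<in>?A. \<Sum>k\<in>?A. cond_expect 0 (\<lambda>t. height_obs f j t 0 * height_obs f k t 0))"
    unfolding S cond_expect_def set_lebesgue_integral_def
    by (simp only: Bochner_Integration.integral_sum Bochner_Integration.integrable_sum int)
  also have "\<dots> \<le> (\<Sum>j\<in>?A. \<Sum>k\<in>?A. 6 * (K * B) * (49 / 50) ^ (max j k - min j k))"
    by (intro sum_mono abs_le_D1[OF correlation_bound]) simp
  also have "\<dots> \<le> (\<Sum>j\<in>?A. 6 * (K * B) * (2 / (1 - 49 / 50)))"
    unfolding sum_distrib_left[symmetric]
    using K_nonneg B_nonneg by (intro sum_mono mult_left_mono sum_geometric_dist_le) auto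
  also have "\<dots> = 600 * (K * B) * real n" by simp
  finally show "(LBINT t. S t) \<le> 600 * (K * B) * real n" .
qed

lemma AE_height_sum_bound:
  assumes "0 < \<epsilon>"
  shows "AE \<theta> in lborel. \<exists>C. \<forall>N\<ge>2.
    \<bar>\<Sum>k=1..N. f (of_int (cf_denom \<theta> k) * \<bar>\<theta> * of_int (cf_denom \<theta> k) - of_int (cf_num \<theta> k)\<bar>)\<bar>
      \<le> C * real N powr (1/2) * ln (real N) powr (3/2 + \<epsilon>)"
proof -
  have "AE t in lborel. \<exists>C. \<forall>N\<ge>2. \<bar>\<Sum>k=1..N. indicat_real {0..1} t * height_obs f k t 0\<bar>
      \<le> C * real N powr (1/2) * ln (real N) powr (3/2 + \<epsilon>)"
    by (rule gal_koksma[OF block_variance assms])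
  then have "AE t in lborel. t \<in> {0..1} \<longrightarrow> (\<exists>C. \<forall>N\<ge>2. \<bar>\<Sum>k=1..N. height_obs f k t 0\<bar>
      \<le> C * real N powr (1/2) * ln (real N) powr (3/2 + \<epsilon>))"
  proof eventually_elim
    case (elim t)
    show ?case
    proof
      assume "t \<in> {0..1}"
      then have "indicat_real {0..1} t = 1" by simp
      with elim show "\<exists>C. \<forall>N\<ge>2. \<bar>\<Sum>k=1..N. height_obs f k t 0\<bar>
          \<le> C * real N powr (1/2) * ln (real N) powr (3/2 + \<epsilon>)"
        by (simp only: mult_1)
    qed
  qed
  from AE_lborel_frac[OF this] AE_irrational show ?thesis
    by eventually_elim (simp add: approx_coeff_eq height_obs_def)
qed

end

theorem theorem1p1:
  fixes F :: "real \<Rightarrow> real" and \<epsilon> :: real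
  assumes "\<And>x. F differentiable (at x)"
    and "bounded (range (deriv F))"
    and "0 < \<epsilon>"
  shows "AE \<theta> in lborel. \<exists>C::real. \<forall>N::nat. 2 \<le> N \<longrightarrow>
    \<bar>(1 / real N) *
        (\<Sum>k=1..N. F (of_int (cf_denom \<theta> k) * \<bar>\<theta> * of_int (cf_denom \<theta> k) - of_int (cf_num \<theta> k)\<bar>))
      - (LINT z:{0..1}|nu. F z)\<bar>
    \<le> C * real N powr (- 1/2) * ln (real N) powr (3/2 + \<epsilon>)"
proof -
  interpret nu: prob_space nu by (rule prob_space_nu)
  have sets_nu [measurable_cong]: "sets nu = sets borel" by (simp add: nu_def)
  obtain K where K: "\<bar>deriv F x\<bar> \<le> K" for x
    using assms(2) by (auto simp: bounded_iff)
  have der: "(F has_real_derivative deriv F x) (at x)" for x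
    using assms(1) by (simp add: DERIV_deriv_iff_real_differentiable)
  have lipF: "\<bar>F x - F y\<bar> \<le> K * \<bar>x - y\<bar>" for x y
    using field_differentiable_bound[of UNIV F "deriv F" K x y] der K by simp
  have K0: "0 \<le> K" using K[of 0] by simp
  \<comment> \<open>F may be unbounded on the line. Clamping its argument keeps the Lipschitz
    constant K and gives the bound |F 0| + K.\<close>
  define c :: "real \<Rightarrow> real" where "c z = max 0 (min 1 z)" for z
  define \<mu> where "\<mu> = (LINT z:{0..1}|nu. F z)"
  define f where "f z = F (c z) - \<mu>" for z
  have c01: "0 \<le> c z" "c z \<le> 1" for z by (simp_all add: c_def)
  have c_id: "c z = z" if "z \<in> {0..1}" for z using that by (simp add: c_def)
  have "continuous_on UNIV F"
    using der by (intro continuous_at_imp_continuous_on ballI DERIV_isCont)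
  then have [measurable]: "F \<in> borel_measurable borel" by (rule borel_measurable_continuous_onI)
  have [measurable]: "(\<lambda>z. F (c z)) \<in> borel_measurable borel" unfolding c_def by measurable
  have Fcb: "\<bar>F (c z)\<bar> \<le> \<bar>F 0\<bar> + K" for z
  proof -
    have "\<bar>F (c z) - F 0\<bar> \<le> K * \<bar>c z - 0\<bar>" by (rule lipF)
    also have "\<dots> \<le> K * 1" using K0 c01[of z] by (intro mult_left_mono) auto
    finally show ?thesis by linarith
  qed
  \<comment> \<open>\<open>nu\<close> is carried by [0, 1], so the clamp does not change the mean
    and subtracting \<mu> centres f.\<close>
  have "AE z in nu. z \<in> {0..1}"
    unfolding nu_def by (subst AE_density) (auto simp: nu_density_def split: if_splits)
  then have \<mu>_eq: "\<mu> = (LINT z|nu. F (c z))"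
    unfolding \<mu>_def set_lebesgue_integral_def
    by (intro integral_cong_AE) (measurable, auto simp: c_id)
  have int: "integrable nu (\<lambda>z. F (c z))"
    by (rule nu.integrable_const_bound[where B = "\<bar>F 0\<bar> + K"]) (use Fcb in auto)
  interpret height_observable f "\<bar>F 0\<bar> + K + \<bar>\<mu>\<bar>" K
  proof
    show "f \<in> borel_measurable borel" unfolding f_def by measurable
    show "\<bar>f x\<bar> \<le> \<bar>F 0\<bar> + K + \<bar>\<mu>\<bar>" for x using Fcb[of x] by (simp add: f_def)
    show "\<bar>f x - f y\<bar> \<le> K * \<bar>x - y\<bar>" for x y
    proof -
      have "\<bar>f x - f y\<bar> \<le> K * \<bar>c x - c y\<bar>" using lipF by (simp add: f_def)
      also have "\<dots> \<le> K * \<bar>x - y\<bar>" using K0 by (intro mult_left_mono) (auto simp: c_def)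
      finally show ?thesis .
    qed
    show "(LINT z|nu. f z) = 0"
      unfolding f_def using int by (simp add: \<mu>_eq nu.prob_space)
  qed
  from AE_height_sum_bound[OF assms(3)] AE_irrational show ?thesis
  proof eventually_elim
    case (elim \<theta>)
    let ?z = "\<lambda>k. of_int (cf_denom \<theta> k) * \<bar>\<theta> * of_int (cf_denom \<theta> k) - of_int (cf_num \<theta> k)\<bar> :: real"
    from elim(1) obtain C where
      C: "\<bar>\<Sum>k=1..N. f (?z k)\<bar> \<le> C * real N powr (1/2) * ln (real N) powr (3/2 + \<epsilon>)" if "2 \<le> N" for N :: nat
      by blast
    show ?case unfolding \<mu>_def[symmetric]
    proof (intro exI[of _ C] allI impI)
      fix N :: nat assume N: "2 \<le> N"
      have "?z k \<in> {0..1}" for k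
        unfolding approx_coeff_eq[OF elim(2)] by (rule gauss_height_orbit_bounds)
      then have "f (?z k) = F (?z k) - \<mu>" for k unfolding f_def using c_id by metis
      then have "(\<Sum>k=1..N. f (?z k)) = (\<Sum>k=1..N. F (?z k)) - real N * \<mu>"
        by (simp add: sum_subtractf)
      then have "(1 / real N) * (\<Sum>k=1..N. F (?z k)) - \<mu> = (1 / real N) * (\<Sum>k=1..N. f (?z k))"
        using N by (simp add: right_diff_distrib)
      then have "\<bar>(1 / real N) * (\<Sum>k=1..N. F (?z k)) - \<mu>\<bar> = (1 / real N) * \<bar>\<Sum>k=1..N. f (?z k)\<bar>"
        by (simp add: abs_mult)
      also have "\<dots> \<le> (1 / real N) * (C * real N powr (1/2) * ln (real N) powr (3/2 + \<epsilon>))"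
        using C[OF N] by (intro mult_left_mono) auto
      also have "\<dots> = C * (real N powr (-1) * real N powr (1/2)) * ln (real N) powr (3/2 + \<epsilon>)"
        using N by (simp add: powr_minus_divide)
      also have "\<dots> = C * real N powr (- 1/2) * ln (real N) powr (3/2 + \<epsilon>)"
        unfolding powr_add[symmetric] by simp
      finally show "\<bar>(1 / real N) * (\<Sum>k=1..N. F (?z k)) - \<mu>\<bar> \<le> C * real N powr (- 1/2) * ln (real N) powr (3/2 + \<epsilon>)" .
    qed
  qed
qed

end
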